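(* For every nonnegative integer $n$, neither the map $Q_{inn}:(\mathfrak{I}^{*}_n, \|\cdot\|_{\infty})\rightarrow (\mathfrak{I}, \|\cdot\|_{\infty})$ nor the map $Q_{out}:(\mathfrak{I}^{*}_n, \|\cdot\|_{\infty})\rightarrow (\mathfrak{F}, \|\cdot\|_{\infty})$ is continuous, where the domain and the targets all carry the metric induced by the supremum norm.
   Context: $\mathbb{D}$ is the open unit disc, $\mathbb{T}$ the unit circle, $H^{\infty}$ the Banach algebra of bounded analytic functions on $\mathbb{D}$ with the supremum norm $\|f\|_{\infty}=\sup_{z\in\mathbb{D}}|f(z)|$, and $(H^{\infty})^{-1}$ the set of invertible elements of $H^{\infty}$. $H^2$ is the classical Hardy space on $\mathbb{D}$. An inner function is a bounded analytic function on $\mathbb{D}$ with unimodular radial limits almost everywhere on $\mathbb{T}$; $\mathfrak{I}$ is the set of all inner functions. An outer function is a bounded analytic function $F$ on $\mathbb{D}$ that is a cyclic vector for the multiplication operator $M_z$ on $H^2$, i.e. the closed linear span of $\{z^kF(z): k\ge 0\}$ is $H^2$; $\mathfrak{F}$ is the set of all outer functions. An inner function $u$ is called normalized if $u^{(n_0)}(0)>0$, where $n_0$ is the smallest nonnegative integer with $u^{(n_0)}(0)\neq 0$. Every nonzero $f\in H^{\infty}$ has a unique factorization $f=uF$ with $u$ a normalized inner function and $F$ an outer function; put $Q_{inn}(f)=u$ and $Q_{out}(f)=F$. $\mathfrak{I}^{*}$ is the set of functions in $H^{\infty}$ of the form $f=uh$ with $u$ an inner function and $h\in (H^{\infty})^{-1}$.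 For nonzero $f\in H^{\infty}$, $\mathrm{Mul}_0(f)=\inf\{k\ge 0: f^{(k)}(0)\neq 0\}$ is the multiplicity of the zero of $f$ at $0$, and for $n=0,1,2,\ldots$, $\mathfrak{I}^{*}_n=\{f\in\mathfrak{I}^{*}: \mathrm{Mul}_0(f)=n\}$. *)

theory Defs
  imports "HOL-Analysis.Analysis"
begin

section \<open>The Banach algebra of bounded analytic functions on the unit disc\<close>

text \<open>
  HOL functions are total, so an analytic function on the disc is represented by its extension
  by zero; equality of representatives is then equality on the disc.
\<close>

typedef hinf =
  "{f :: complex \<Rightarrow> complex. f holomorphic_on ball 0 1 \<and> bounded (f ` ball 0 1) \<and>
      (\<forall>z. z \<notin> ball 0 1 \<longrightarrow> f z = 0)}"
  morphisms happ Abs_hinf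
  by (rule exI [of _ "\<lambda>_. 0"]) (auto simp: image_constant_conv)

setup_lifting type_definition_hinf

lemma happ_holomorphic: "happ f holomorphic_on ball 0 1"
  and happ_bounded: "bounded (happ f ` ball 0 1)"
  and happ_outside: "z \<notin> ball 0 1 \<Longrightarrow> happ f z = 0"
  using happ [of f] by auto

lemma hinf_eqI: "(\<And>z. z \<in> ball 0 1 \<Longrightarrow> happ f z = happ g z) \<Longrightarrow> f = g"
  by (metis happ_inject happ_outside ext)

lemma bounded_image_mult:
  fixes f g :: "'a \<Rightarrow> 'b::real_normed_algebra"
  assumes "bounded (f ` S)" "bounded (g ` S)"
  shows "bounded ((\<lambda>z. f z * g z) ` S)"
proof -
  obtain a b where ab: "\<And>z. z \<in> S \<Longrightarrow> norm (f z) \<le> a" "\<And>z. z \<in> S \<Longrightarrow> norm (g z) \<le> b"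
    using assms unfolding bounded_iff by (metis imageI)
  have "norm (f z * g z) \<le> a * b" if "z \<in> S" for z
    using ab [OF that] norm_mult_ineq [of "f z" "g z"]
    by (meson mult_mono' norm_ge_zero order_trans)
  then show ?thesis
    unfolding bounded_iff by (metis (no_types, lifting) imageE)
qed

instantiation hinf :: comm_ring_1
begin

lift_definition zero_hinf :: hinf is "\<lambda>_. 0"
  by (auto simp: image_constant_conv)

lift_definition one_hinf :: hinf is "\<lambda>z. if z \<in> ball 0 1 then 1 else 0"
proof -
  have "(\<lambda>z::complex. if z \<in> ball 0 1 then 1 else 0 :: complex) holomorphic_on ball 0 1"
    by (rule holomorphic_transform [OF holomorphic_on_const [of 1]]) auto
  moreover have "bounded ((\<lambda>z::complex. if z \<in> ball 0 1 then 1 else 0 :: complex) ` ball 0 1)"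
    unfolding bounded_iff by (rule exI [of _ 1]) auto
  ultimately show "?thesis" by auto
qed

lift_definition plus_hinf :: "hinf \<Rightarrow> hinf \<Rightarrow> hinf" is "\<lambda>f g z. f z + g z"
  by (auto intro: holomorphic_intros bounded_plus_comp)

lift_definition minus_hinf :: "hinf \<Rightarrow> hinf \<Rightarrow> hinf" is "\<lambda>f g z. f z - g z"
  by (auto intro: holomorphic_intros bounded_minus_comp)

lift_definition uminus_hinf :: "hinf \<Rightarrow> hinf" is "\<lambda>f z. - f z"
  by (auto intro: holomorphic_intros simp: bounded_iff)

lift_definition times_hinf :: "hinf \<Rightarrow> hinf \<Rightarrow> hinf" is "\<lambda>f g z. f z * g z"
  by (auto intro: holomorphic_intros bounded_image_mult)

instance
proof
  fix f g h :: hinf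
  show "f * g * h = f * (g * h)" "f * g = g * f" "f + g + h = f + (g + h)" "f + g = g + f"
    "0 + f = f" "- f + f = 0" "f - g = f + - g" "(f + g) * h = f * h + g * h"
    by (transfer; simp add: fun_eq_iff algebra_simps)+
  show "1 * f = f"
    by transfer (auto simp: fun_eq_iff)
  have "happ 0 0 \<noteq> happ 1 0"
    by (simp add: zero_hinf.rep_eq one_hinf.rep_eq)
  then show "(0 :: hinf) \<noteq> 1"
    by metis
qed

end

instantiation hinf :: real_normed_algebra_1
begin

lift_definition scaleR_hinf :: "real \<Rightarrow> hinf \<Rightarrow> hinf" is "\<lambda>c f z. c *\<^sub>R f z"
proof -
  fix c :: real and f :: "complex \<Rightarrow> complex"
  assume f: "f holomorphic_on ball 0 1 \<and> bounded (f ` ball 0 1) \<and>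
    (\<forall>z. z \<notin> ball 0 1 \<longrightarrow> f z = 0)"
  have "(\<lambda>z. c *\<^sub>R f z) holomorphic_on ball 0 1"
    unfolding scaleR_conv_of_real using f by (intro holomorphic_intros) auto
  moreover have "bounded ((\<lambda>z. c *\<^sub>R f z) ` ball 0 1)"
    using f by (intro bounded_scaleR_comp) auto
  ultimately show "(\<lambda>z. c *\<^sub>R f z) holomorphic_on ball 0 1 \<and> bounded ((\<lambda>z. c *\<^sub>R f z) ` ball 0 1) \<and>
      (\<forall>z. z \<notin> ball 0 1 \<longrightarrow> c *\<^sub>R f z = 0)"
    using f by auto
qed

definition norm_hinf :: "hinf \<Rightarrow> real"
  where "norm_hinf f = (SUP z\<in>ball 0 1. norm (happ f z))"

definition sgn_hinf :: "hinf \<Rightarrow> hinf"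
  where "sgn_hinf f = inverse (norm f) *\<^sub>R f"

definition dist_hinf :: "hinf \<Rightarrow> hinf \<Rightarrow> real"
  where "dist_hinf f g = norm (f - g)"

definition uniformity_hinf :: "(hinf \<times> hinf) filter"
  where "uniformity_hinf = (INF e\<in>{0<..}. principal {(f, g). dist f g < e})"

definition open_hinf :: "hinf set \<Rightarrow> bool"
  where "open_hinf U \<longleftrightarrow> (\<forall>f\<in>U. \<forall>\<^sub>F (f', g) in uniformity. f' = f \<longrightarrow> g \<in> U)"

lemma norm_happ_le: "norm (happ f z) \<le> norm f"
proof (cases "z \<in> ball 0 1")
  case True
  have "bdd_above ((\<lambda>z. norm (happ f z)) ` ball 0 1)"
    using happ_bounded [of f] unfolding bounded_iff bdd_above_def by auto
  then show ?thesis
    unfolding norm_hinf_def using True by (rule cSUP_upper2) auto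
next
  case False
  have "bdd_above ((\<lambda>z. norm (happ f z)) ` ball 0 1)"
    using happ_bounded [of f] unfolding bounded_iff bdd_above_def by auto
  then have "norm (happ f 0) \<le> norm f"
    unfolding norm_hinf_def by (rule cSUP_upper2) auto
  then show ?thesis
    using norm_ge_zero [of "happ f 0"] by (simp add: happ_outside [OF False] del: norm_ge_zero)
qed

lemma norm_hinf_leI: "(\<And>z. z \<in> ball 0 1 \<Longrightarrow> norm (happ f z) \<le> b) \<Longrightarrow> norm f \<le> b"
  unfolding norm_hinf_def by (rule cSUP_least) auto

instance
proof
  fix f g :: hinf and a b :: real
  show "dist f g = norm (f - g)" by (rule dist_hinf_def)
  show "sgn f = inverse (norm f) *\<^sub>R f" by (rule sgn_hinf_def)
  show "uniformity = (INF e\<in>{0<..}. principal {(f :: hinf, g). dist f g < e})"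
    by (rule uniformity_hinf_def)
  show "open U \<longleftrightarrow> (\<forall>f\<in>U. \<forall>\<^sub>F (f', g) in uniformity. f' = f \<longrightarrow> g \<in> U)" for U :: "hinf set"
    by (rule open_hinf_def)
  show "a *\<^sub>R (f + g) = a *\<^sub>R f + a *\<^sub>R g" "(a + b) *\<^sub>R f = a *\<^sub>R f + b *\<^sub>R f"
    "a *\<^sub>R b *\<^sub>R f = (a * b) *\<^sub>R f" "1 *\<^sub>R f = f"
    "a *\<^sub>R f * g = a *\<^sub>R (f * g)" "f * a *\<^sub>R g = a *\<^sub>R (f * g)"
    by (transfer; auto simp: fun_eq_iff algebra_simps)+
  show "norm f = 0 \<longleftrightarrow> f = 0"
  proof
    assume "norm f = 0"
    then show "f = 0"
      using norm_happ_le [of f] by (intro hinf_eqI) (auto simp: zero_hinf.rep_eq)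
  next
    assume "f = 0"
    then show "norm f = 0"
      by (simp add: norm_hinf_def zero_hinf.rep_eq)
  qed
  show "norm (f + g) \<le> norm f + norm g"
    by (rule norm_hinf_leI)
      (metis add_mono norm_happ_le norm_triangle_ineq order_trans plus_hinf.rep_eq)
  show "norm (f * g) \<le> norm f * norm g"
    by (rule norm_hinf_leI)
      (simp add: times_hinf.rep_eq norm_mult mult_mono' norm_happ_le)
  show "norm (a *\<^sub>R f) = \<bar>a\<bar> * norm f"
  proof (rule antisym)
    show "norm (a *\<^sub>R f) \<le> \<bar>a\<bar> * norm f"
      by (rule norm_hinf_leI) (simp add: scaleR_hinf.rep_eq mult_left_mono norm_happ_le)
    show "\<bar>a\<bar> * norm f \<le> norm (a *\<^sub>R f)"
    proof (cases "a = 0")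
      case True
      then show ?thesis
        using order_trans [OF norm_ge_zero norm_happ_le [of "a *\<^sub>R f" 0]] by simp
    next
      case False
      have "norm f \<le> norm (a *\<^sub>R f) / \<bar>a\<bar>"
      proof (rule norm_hinf_leI)
        fix z
        show "norm (happ f z) \<le> norm (a *\<^sub>R f) / \<bar>a\<bar>"
          using norm_happ_le [of "a *\<^sub>R f" z] False
          by (simp add: scaleR_hinf.rep_eq field_simps)
      qed
      then show ?thesis
        using False by (simp add: field_simps)
    qed
  qed
  show "norm (1 :: hinf) = 1"
  proof -
    have "(\<lambda>z. norm (happ 1 z)) ` ball 0 1 = {1}"
      by (auto simp: one_hinf.rep_eq image_iff intro!: exI [of _ 0])
    then show ?thesis
      by (simp add: norm_hinf_def)
  qed
qed

end

section \<open>The Hardy space and outer functions\<close>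

definition mean_square :: "(complex \<Rightarrow> complex) \<Rightarrow> real \<Rightarrow> real"
  where "mean_square f r =
    (1 / (2 * pi)) * integral {0..2 * pi} (\<lambda>t. (norm (f (of_real r * cis t)))\<^sup>2)"

text \<open>
  Values off the disc are unconstrained in \<open>H2\<close> and do not affect \<open>H2_norm\<close>.
\<close>

definition H2 :: "(complex \<Rightarrow> complex) set"
  where "H2 = {f. f holomorphic_on ball 0 1 \<and> bdd_above (mean_square f ` {0<..<1})}"

definition H2_norm :: "(complex \<Rightarrow> complex) \<Rightarrow> real"
  where "H2_norm f = sqrt (SUP r\<in>{0<..<1}. mean_square f r)"

definition lin_span :: "(complex \<Rightarrow> complex) set \<Rightarrow> (complex \<Rightarrow> complex) set"
  where "lin_span S = {\<lambda>z. \<Sum>f\<in>T. c f * f z | T c. finite T \<and> T \<subseteq> S}"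

definition H2_closure :: "(complex \<Rightarrow> complex) set \<Rightarrow> (complex \<Rightarrow> complex) set"
  where "H2_closure S = {g \<in> H2. \<forall>\<epsilon>>0. \<exists>h\<in>S. H2_norm (\<lambda>z. g z - h z) < \<epsilon>}"

definition outer :: "hinf \<Rightarrow> bool"
  where "outer F \<longleftrightarrow> H2_closure (lin_span {\<lambda>z. z ^ k * happ F z | k :: nat. True}) = H2"

section \<open>Inner functions and the inner-outer factorization\<close>

definition inner_fun :: "hinf \<Rightarrow> bool"
  where "inner_fun u \<longleftrightarrow>
    (AE t in lebesgue_on {0..2 * pi}.
      \<exists>l. norm l = 1 \<and> ((\<lambda>r. happ u (of_real r * cis t)) \<longlongrightarrow> l) (at_left 1))"

definition Mul0 :: "hinf \<Rightarrow> nat"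
  where "Mul0 f = (LEAST k. (deriv ^^ k) (happ f) 0 \<noteq> 0)"

definition normalized_inner :: "hinf \<Rightarrow> bool"
  where "normalized_inner u \<longleftrightarrow>
    inner_fun u \<and> (deriv ^^ Mul0 u) (happ u) 0 \<in> \<real> \<and> Re ((deriv ^^ Mul0 u) (happ u) 0) > 0"

definition inner_outer :: "hinf \<Rightarrow> hinf \<times> hinf"
  where "inner_outer f = (THE (u, F). normalized_inner u \<and> outer F \<and> f = u * F)"

definition Q_inn :: "hinf \<Rightarrow> hinf"
  where "Q_inn f = fst (inner_outer f)"

definition Q_out :: "hinf \<Rightarrow> hinf"
  where "Q_out f = snd (inner_outer f)"

text \<open>In a commutative ring, \<open>h dvd 1\<close> says that \<open>h\<close> is invertible.\<close>

definition I_star :: "hinf set"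
  where "I_star = {u * h | u h. inner_fun u \<and> h dvd 1}"

definition I_star_n :: "nat \<Rightarrow> hinf set"
  where "I_star_n n = {f \<in> I_star. Mul0 f = n}"

end

theory Submission
  imports Defs "HOL-Complex_Analysis.Complex_Analysis"
begin

text \<open>
  The factorization is discontinuous because the modulus of a function on the circle controls the
  modulus of its outer factor, but not the argument: a harmonic function can be uniformly small while
  its conjugate is not. To exploit this, the disc is mapped conformally onto the strip
  \<open>\<bar>Im s\<bar> < pi / 2\<close>. There \<open>exp (\<i> * \<phi> * s)\<close> is an invertible bounded function for every real \<open>\<phi>\<close>. As
  \<open>\<phi>\<close> tends to 0 its modulus tends to 1 uniformly, but far out on the real axis its argument takes all
  values.

  This drift of the argument can be compensated by inner functions. Let \<open>u\<close> be a Blaschke product of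
  the strip whose zeros are the odd integers moved by \<open>\<i> * \<phi>\<close>; it is a quotient of two theta functions
  (\<open>strip_inner\<close>). Translation by 2 multiplies \<open>u\<close> by \<open>- exp (- (2 * \<i> * \<phi>))\<close>
  (\<open>strip_inner_shift\<close>), so it multiplies the product of \<open>u\<close> and \<open>exp (\<i> * \<phi> * s)\<close> by \<open>- 1\<close>,
  independently of \<open>\<phi>\<close>. Convergence of these products as \<open>\<phi>\<close> tends to 0 therefore needs to be checked
  only on a compact fundamental domain, and is uniform on the strip (\<open>strip_fun_uniform_limit\<close>).
  Multiplied by \<open>z ^ n\<close> on the disc, the products form a convergent family in \<open>I_star_n n\<close>, whereas
  their outer factors do not converge (\<open>outer_parts_apart\<close>). If the inner factors converged, then so
  would the outer factors after multiplication by the limit of the inner ones, and the lower bound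
  excludes this as well.

  It remains to see that the obvious factors are the ones selected by \<open>inner_outer\<close>
  (\<open>inner_outer_unit\<close>). Invertible functions are outer because polynomials are dense in \<open>H2\<close>
  (\<open>outer_if_unit\<close>). Uniqueness reduces to the fact that a function which is both inner and outer is
  constant (\<open>inner_and_outer_imp_constant\<close>); it follows from Parseval's identity and the fact that
  inner functions preserve the boundary square mean.
\<close>

section \<open>Square means and Taylor coefficients\<close>

lemma integral_cis_nonzero:
  assumes "k \<noteq> (0::int)"
  shows "((\<lambda>t. cis (of_int k * t)) has_integral 0) {0..2 * pi}"
proof -
  let ?F = "\<lambda>t::real. cis (of_int k * t) / (\<i> * of_int k)"
  have "((\<lambda>t. cis (of_int k * t)) has_integral (?F (2 * pi) - ?F 0)) {0..2 * pi}"
  proof (rule fundamental_theorem_of_calculus)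
    fix t :: real
    have "((\<lambda>z. exp (\<i> * (of_int k * z)) / (\<i> * of_int k)) has_field_derivative
        exp (\<i> * (of_int k * of_real t))) (at (of_real t))"
      by (rule derivative_eq_intros refl | simp add: assms mult.assoc [symmetric])+
    from has_vector_derivative_real_field [OF this]
    show "(?F has_vector_derivative cis (of_int k * t)) (at t within {0..2 * pi})"
      by (simp add: cis_conv_exp has_vector_derivative_at_within)
  qed simp
  moreover have "cis (of_int k * (2 * pi)) = 1"
    using cis_multiple_2pi [of "of_int k"] by (simp add: mult_ac)
  ultimately show ?thesis
    by simp
qed

lemma has_integral_norm_square_trig_sum:
  "((\<lambda>t. (norm (\<Sum>n<N. b n * cis (real n * t)))\<^sup>2) has_integral
     2 * pi * (\<Sum>n<N. (norm (b n))\<^sup>2)) {0..2 * pi}"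
proof (induction N)
  case 0
  then show ?case by simp
next
  case (Suc N)
  let ?S = "\<lambda>t::real. \<Sum>n<N. b n * cis (real n * t)"
  have split: "(norm (x + y))\<^sup>2 = (norm x)\<^sup>2 + (norm y)\<^sup>2 + 2 * Re (x * cnj y)" for x y :: complex
    unfolding cmod_power2 by (simp add: power2_eq_square algebra_simps)
  have "((\<lambda>t. b n * cnj (b N) * cis (of_int (int n - int N) * t)) has_integral
      b n * cnj (b N) * 0) {0..2 * pi}" if "n < N" for n
    by (rule has_integral_mult_right, rule integral_cis_nonzero) (use that in auto)
  then have "((\<lambda>t. \<Sum>n<N. b n * cnj (b N) * cis (of_int (int n - int N) * t)) has_integral
      (\<Sum>n<N. b n * cnj (b N) * 0)) {0..2 * pi}"
    by (intro has_integral_sum) auto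
  moreover have "(\<Sum>n<N. b n * cnj (b N) * cis (of_int (int n - int N) * t)) =
      ?S t * cnj (b N * cis (real N * t))" for t :: real
    unfolding sum_distrib_right
  proof (rule sum.cong)
    fix n
    have "cis (of_int (int n - int N) * t) = cis (real n * t) * cnj (cis (real N * t))"
      by (simp add: cis_cnj cis_mult algebra_simps)
    then show "b n * cnj (b N) * cis (of_int (int n - int N) * t) =
        b n * cis (real n * t) * cnj (b N * cis (real N * t))"
      by (simp only: complex_cnj_mult mult_ac)
  qed simp
  ultimately have "((\<lambda>t. ?S t * cnj (b N * cis (real N * t))) has_integral 0) {0..2 * pi}"
    by simp
  then have cross: "((\<lambda>t. Re (?S t * cnj (b N * cis (real N * t)))) has_integral 0) {0..2 * pi}"
    using has_integral_linear [OF _ bounded_linear_Re, of _ 0 "{0..2 * pi}"]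
    unfolding o_def by fastforce
  have diag: "((\<lambda>t. (norm (b N * cis (real N * t)))\<^sup>2) has_integral 2 * pi * (norm (b N))\<^sup>2)
      {0..2 * pi}"
    using has_integral_const_real [of "(norm (b N))\<^sup>2" 0 "2 * pi"] by (simp add: norm_mult)
  have "((\<lambda>t. (norm (?S t))\<^sup>2 + (norm (b N * cis (real N * t)))\<^sup>2 +
      2 * Re (?S t * cnj (b N * cis (real N * t)))) has_integral
      2 * pi * (\<Sum>n<N. (norm (b n))\<^sup>2) + 2 * pi * (norm (b N))\<^sup>2 + 2 * 0) {0..2 * pi}"
    by (intro has_integral_add has_integral_mult_right Suc diag cross)
  then have "((\<lambda>t. (norm (?S t + b N * cis (real N * t)))\<^sup>2) has_integral
      2 * pi * (\<Sum>n<N. (norm (b n))\<^sup>2) + 2 * pi * (norm (b N))\<^sup>2) {0..2 * pi}"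
    unfolding split by simp
  then show ?case
    unfolding sum.lessThan_Suc distrib_left .
qed

text \<open>
  Parseval's identity on a circle inside the disc. It turns all statements about \<open>H2\<close> below into
  statements about Taylor coefficients.
\<close>

lemma mean_square_sums:
  assumes f: "\<And>z. z \<in> ball 0 1 \<Longrightarrow> (\<lambda>n. a n * z ^ n) sums f z" and r: "0 < r" "r < 1"
  shows "(\<lambda>n. (norm (a n))\<^sup>2 * r ^ (2 * n)) sums mean_square f r"
proof -
  define b where "b n = a n * of_real r ^ n" for n
  have "summable (\<lambda>n. a n * of_real ((1 + r) / 2) ^ n)"
    using f [of "of_real ((1 + r) / 2)"] r by (auto simp: sums_iff simp del: of_real_divide of_real_add)
  then have sb: "summable (\<lambda>n. norm (b n))"
    unfolding b_def by (rule powser_insidea) (use r in \<open>auto simp del: of_real_divide of_real_add\<close>)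
  have val: "(\<Sum>n. b n * cis (real n * t)) = f (of_real r * cis t)" for t
    using f [of "of_real r * cis t"] r
    by (simp add: sums_iff b_def power_mult_distrib Complex.DeMoivre norm_mult mult.assoc )
  have "uniform_limit {0..2 * pi} (\<lambda>N t. \<Sum>n<N. b n * cis (real n * t))
      (\<lambda>t. \<Sum>n. b n * cis (real n * t)) sequentially"
    by (rule Weierstrass_m_test [OF _ sb]) (simp add: norm_mult)
  then have U: "uniform_limit {0..2 * pi} (\<lambda>N t. \<Sum>n<N. b n * cis (real n * t))
      (\<lambda>t. f (of_real r * cis t)) sequentially"
    by (simp add: val)
  have "bounded ((\<lambda>t. f (of_real r * cis t)) ` {0..2 * pi})"
  proof (rule boundedI, clarify)
    fix t
    have "norm (\<Sum>n. b n * cis (real n * t)) \<le> (\<Sum>n. norm (b n * cis (real n * t)))"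
      by (rule summable_norm) (use sb in \<open>simp add: norm_mult\<close>)
    then show "norm (f (of_real r * cis t)) \<le> (\<Sum>n. norm (b n))"
      by (simp add: val norm_mult)
  qed
  then have "bounded ((\<lambda>t. norm (f (of_real r * cis t))) ` {0..2 * pi})"
    by (simp add: bounded_iff)
  then have "uniform_limit {0..2 * pi} (\<lambda>N t. norm (\<Sum>n<N. b n * cis (real n * t)) *
      norm (\<Sum>n<N. b n * cis (real n * t)))
      (\<lambda>t. norm (f (of_real r * cis t)) * norm (f (of_real r * cis t))) sequentially"
    by (intro uniform_lim_mult uniform_limit_norm U)
  then have U2: "uniform_limit {0..2 * pi} (\<lambda>N t. (norm (\<Sum>n<N. b n * cis (real n * t)))\<^sup>2)
      (\<lambda>t. (norm (f (of_real r * cis t)))\<^sup>2) sequentially"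
    by (simp add: power2_eq_square)
  have "continuous_on {0..2 * pi} (\<lambda>t. (norm (\<Sum>n<N. b n * cis (real n * t)))\<^sup>2)" for N
    by (intro continuous_intros)
  then obtain I J where
    I: "\<And>N. ((\<lambda>t. (norm (\<Sum>n<N. b n * cis (real n * t)))\<^sup>2) has_integral I N) {0..2 * pi}"
    and J: "((\<lambda>t. (norm (f (of_real r * cis t)))\<^sup>2) has_integral J) {0..2 * pi}"
    and IJ: "I \<longlonglongrightarrow> J"
    by (rule uniform_limit_integral [OF U2 _ sequentially_bot]) blast
  have "I N = 2 * pi * (\<Sum>n<N. (norm (b n))\<^sup>2)" for N
    using I [of N] has_integral_norm_square_trig_sum [where N = N and b = b] has_integral_unique by blast
  then have "(\<lambda>N. (1 / (2 * pi)) * (2 * pi * (\<Sum>n<N. (norm (b n))\<^sup>2))) \<longlonglongrightarrow> (1 / (2 * pi)) * J"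
    using tendsto_mult_left [OF IJ, of "1 / (2 * pi)"] by simp
  then have "(\<lambda>n. (norm (b n))\<^sup>2) sums mean_square f r"
    using J by (simp add: sums_def mean_square_def integral_unique)
  moreover have "(norm (b n))\<^sup>2 = (norm (a n))\<^sup>2 * r ^ (2 * n)" for n
    using r by (simp add: b_def norm_mult norm_power power_mult_distrib power_mult [symmetric] mult.commute)
  ultimately show ?thesis by simp
qed

lemma taylor_sums:
  assumes "f holomorphic_on ball 0 1" "z \<in> ball 0 1"
  shows "(\<lambda>n. ((deriv ^^ n) f 0 / fact n) * z ^ n) sums f z"
  using holomorphic_power_series [OF assms(1,2)] by simp

lemma integrable_square_circle:
  assumes "f holomorphic_on ball 0 1" "0 < r" "r < 1"
  shows "(\<lambda>t. (norm (f (of_real r * cis t)))\<^sup>2) integrable_on {0..2 * pi}"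
proof -
  have "continuous_on {0..2 * pi} (\<lambda>t. f (of_real r * cis t))"
    using assms
    by (intro continuous_on_compose2 [OF holomorphic_on_imp_continuous_on, OF assms(1)]
        continuous_intros) (auto simp: norm_mult)
  then show ?thesis
    by (intro integrable_continuous_real continuous_intros)
qed

text \<open>
  Monotonicity of the square mean, in the one form needed: multipliers give \<open>A = 0\<close>, bounded
  functions give \<open>B = 0\<close>, and a weighted triangle inequality uses both terms.
\<close>

lemma mean_square_affine_bound:
  assumes f: "f holomorphic_on ball 0 1" and g: "g holomorphic_on ball 0 1" and r: "0 < r" "r < 1"
    and le: "\<And>z. z \<in> ball 0 1 \<Longrightarrow> (norm (f z))\<^sup>2 \<le> A + B * (norm (g z))\<^sup>2"
  shows "mean_square f r \<le> A + B * mean_square g r"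
proof -
  let ?I = "\<lambda>h. integral {0..2 * pi} (\<lambda>t. (norm (h (of_real r * cis t) :: complex))\<^sup>2)"
  have "?I f \<le> integral {0..2 * pi} (\<lambda>t. A + B * (norm (g (of_real r * cis t)))\<^sup>2)"
    by (intro integral_le integrable_square_circle integrable_add integrable_on_const integrable_on_mult_right
        f g r le) (use r in \<open>auto simp: norm_mult\<close>)
  also have "\<dots> = 2 * pi * A + B * ?I g"
    using integrable_square_circle [OF g r]
    by (subst integral_add) (auto intro: integrable_on_mult_right)
  finally show ?thesis
    by (simp add: mean_square_def field_simps)
qed

lemma mean_square_bound:
  assumes "f holomorphic_on ball 0 1" "0 < r" "r < 1" "\<And>z. z \<in> ball 0 1 \<Longrightarrow> norm (f z) \<le> M"
  shows "mean_square f r \<le> M\<^sup>2"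
  using mean_square_affine_bound [of f "\<lambda>_. 0" r "M\<^sup>2" 0] assms by (simp add: power_mono)

lemma bounded_imp_H2:
  assumes "f holomorphic_on ball 0 1" "bounded (f ` ball 0 1)"
  shows "f \<in> H2"
proof -
  obtain M where "\<And>z. z \<in> ball 0 1 \<Longrightarrow> norm (f z) \<le> M"
    using assms(2) unfolding bounded_iff by blast
  then have "bdd_above (mean_square f ` {0<..<1})"
    using mean_square_bound [OF assms(1)] by (intro bdd_aboveI [of _ "M\<^sup>2"]) auto
  then show ?thesis
    using assms(1) by (simp add: H2_def)
qed

lemma mean_square_nonneg:
  assumes "f holomorphic_on ball 0 1" "0 < r" "r < 1"
  shows "0 \<le> mean_square f r"
  using integrable_square_circle [OF assms]
  by (auto simp: mean_square_def intro!: divide_nonneg_pos integral_nonneg)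

lemma mean_square_le_Sup:
  assumes "f \<in> H2" "0 < r" "r < 1"
  shows "mean_square f r \<le> (SUP r\<in>{0<..<1}. mean_square f r)"
  using assms by (intro cSUP_upper) (auto simp: H2_def)

lemma H2_norm_nonneg:
  assumes "f \<in> H2"
  shows "0 \<le> H2_norm f"
  using mean_square_nonneg [of f "1 / 2"] mean_square_le_Sup [OF assms, of "1 / 2"] assms
  by (simp add: H2_norm_def H2_def)

lemma mean_square_le_H2_norm:
  assumes "f \<in> H2" "0 < r" "r < 1"
  shows "mean_square f r \<le> (H2_norm f)\<^sup>2"
  using mean_square_nonneg [of f r] mean_square_le_Sup [OF assms] assms
  by (simp add: H2_norm_def H2_def)

lemma H2_norm_less:
  assumes "\<And>r. 0 < r \<Longrightarrow> r < 1 \<Longrightarrow> mean_square f r \<le> B" "B < \<epsilon>\<^sup>2" "0 < \<epsilon>"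
  shows "H2_norm f < \<epsilon>"
proof -
  have "(SUP r\<in>{0<..<1}. mean_square f r) \<le> B"
    by (rule cSUP_least) (use assms(1) in auto)
  then show ?thesis
    unfolding H2_norm_def using assms(2,3) by (intro real_less_lsqrt) auto
qed

lemma norm_value_at_0_le_mean_square:
  assumes "f holomorphic_on ball 0 1" "0 < r" "r < 1"
  shows "(norm (f 0))\<^sup>2 \<le> mean_square f r"
proof -
  have "(\<lambda>n. (norm ((deriv ^^ n) f 0 / fact n))\<^sup>2 * r ^ (2 * n)) sums mean_square f r"
    by (rule mean_square_sums) (use taylor_sums assms in auto)
  from sum_le_suminf [OF sums_summable [OF this], of "{0}"] sums_unique [OF this] show ?thesis
    by simp
qed

lemma H2_square_summable:
  assumes "f \<in> H2" and f: "\<And>z. z \<in> ball 0 1 \<Longrightarrow> (\<lambda>n. a n * z ^ n) sums f z"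
  shows "summable (\<lambda>n. (norm (a n))\<^sup>2)"
proof (rule bounded_imp_summable)
  show "(\<Sum>n\<le>N. (norm (a n))\<^sup>2) \<le> (H2_norm f)\<^sup>2" for N
  proof (rule tendsto_upperbound)
    have "((\<lambda>r. \<Sum>n\<le>N. (norm (a n))\<^sup>2 * r ^ (2 * n)) \<longlongrightarrow> (\<Sum>n\<le>N. (norm (a n))\<^sup>2 * 1 ^ (2 * n)))
        (at_left (1::real))"
      by (intro tendsto_intros)
    then show "((\<lambda>r. \<Sum>n\<le>N. (norm (a n))\<^sup>2 * r ^ (2 * n)) \<longlongrightarrow> (\<Sum>n\<le>N. (norm (a n))\<^sup>2)) (at_left (1::real))"
      by simp
    have "(\<Sum>n\<le>N. (norm (a n))\<^sup>2 * r ^ (2 * n)) \<le> (H2_norm f)\<^sup>2" if r: "0 < r" "r < 1" for r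
    proof -
      have s: "(\<lambda>n. (norm (a n))\<^sup>2 * r ^ (2 * n)) sums mean_square f r"
        using mean_square_sums [OF f r] by blast
      have "(\<Sum>n\<le>N. (norm (a n))\<^sup>2 * r ^ (2 * n)) \<le> mean_square f r"
        using sum_le_suminf [OF sums_summable [OF s], of "{..N}"] sums_unique [OF s] r by simp
      also have "\<dots> \<le> (H2_norm f)\<^sup>2"
        using mean_square_le_H2_norm assms(1) r by blast
      finally show ?thesis .
    qed
    then show "\<forall>\<^sub>F r in at_left 1. (\<Sum>n\<le>N. (norm (a n))\<^sup>2 * r ^ (2 * n)) \<le> (H2_norm f)\<^sup>2"
      using eventually_at_left_real [of 0 "1::real"] by (auto elim!: eventually_mono)
  qed simp
qed simp

text \<open>
  By Parseval, the square mean of a Taylor remainder is a tail of the convergent series of squared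
  coefficients, and this estimate does not depend on the radius.
\<close>

lemma H2_polynomials_dense:
  assumes "f \<in> H2" "0 < \<epsilon>"
  shows "\<exists>a N. \<forall>r. 0 < r \<longrightarrow> r < 1 \<longrightarrow> mean_square (\<lambda>z. f z - (\<Sum>n<N. a n * z ^ n)) r \<le> \<epsilon>"
proof -
  define a where "a n = (deriv ^^ n) f 0 / fact n" for n
  have f: "(\<lambda>n. a n * z ^ n) sums f z" if "z \<in> ball 0 1" for z
    using taylor_sums assms(1) that by (auto simp: H2_def a_def)
  have sa: "summable (\<lambda>n. (norm (a n))\<^sup>2)"
    using H2_square_summable assms(1) f by blast
  from suminf_exist_split [OF assms(2) this] obtain N where
    N: "norm (\<Sum>n. (norm (a (n + N)))\<^sup>2) < \<epsilon>"
    by blast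
  have "mean_square (\<lambda>z. f z - (\<Sum>n<N. a n * z ^ n)) r \<le> \<epsilon>" if r: "0 < r" "r < 1" for r
  proof -
    define b where "b n = (if n < N then 0 else a n)" for n
    have "(\<lambda>n. b n * z ^ n) sums (f z - (\<Sum>n<N. a n * z ^ n))" if "z \<in> ball 0 1" for z
    proof -
      have "(\<lambda>n. a n * z ^ n - (if n \<in> {..<N} then a n * z ^ n else 0)) sums
          (f z - (\<Sum>n<N. a n * z ^ n))"
        by (intro sums_diff f that sums_If_finite_set) auto
      then show ?thesis
        by (rule back_subst [where P = "\<lambda>h. h sums _"]) (auto simp: b_def)
    qed
    then have s: "(\<lambda>n. (norm (b n))\<^sup>2 * r ^ (2 * n)) sums
        mean_square (\<lambda>z. f z - (\<Sum>n<N. a n * z ^ n)) r"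
      using r by (intro mean_square_sums) auto
    have "mean_square (\<lambda>z. f z - (\<Sum>n<N. a n * z ^ n)) r =
        (\<Sum>n. (norm (b (n + N)))\<^sup>2 * r ^ (2 * (n + N)))"
    proof -
      have "(\<Sum>n<N. (norm (b n))\<^sup>2 * r ^ (2 * n)) = 0"
        by (rule sum.neutral) (simp add: b_def)
      with sums_split_initial_segment [OF s, of N]
      have "(\<lambda>n. (norm (b (n + N)))\<^sup>2 * r ^ (2 * (n + N))) sums
          mean_square (\<lambda>z. f z - (\<Sum>n<N. a n * z ^ n)) r"
        by (simp only: diff_zero)
      then show ?thesis
        by (rule sums_unique)
    qed
    also have "\<dots> \<le> (\<Sum>n. (norm (a (n + N)))\<^sup>2)"
    proof (rule suminf_le)
      show "summable (\<lambda>n. (norm (b (n + N)))\<^sup>2 * r ^ (2 * (n + N)))"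
        by (rule summable_ignore_initial_segment [OF sums_summable [OF s]])
      show "summable (\<lambda>n. (norm (a (n + N)))\<^sup>2)"
        by (rule summable_ignore_initial_segment [OF sa])
      show "(norm (b (n + N)))\<^sup>2 * r ^ (2 * (n + N)) \<le> (norm (a (n + N)))\<^sup>2" for n
        using r by (simp add: b_def mult_left_le power_le_one)
    qed
    finally show ?thesis
      using N by simp
  qed
  then show ?thesis by blast
qed

section \<open>Invertible functions are outer\<close>

lemma happ_times [simp]: "happ (f * g) z = happ f z * happ g z"
  by (simp add: times_hinf.rep_eq)

lemma happ_one: "z \<in> ball 0 1 \<Longrightarrow> happ 1 z = 1"
  by (simp add: one_hinf.rep_eq)

text \<open>
  Different indices may give the same function, so the coefficients of equal members have to be
  collected before the sum becomes one over a finite set of functions.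
\<close>

lemma lin_span_family_sum:
  fixes g :: "nat \<Rightarrow> complex \<Rightarrow> complex"
  shows "(\<lambda>z. \<Sum>k<N. a k * g k z) \<in> lin_span {g k | k. True}"
proof -
  define c where "c f = (\<Sum>k\<in>{k \<in> {..<N}. g k = f}. a k)" for f
  have "(\<Sum>k<N. a k * g k z) = (\<Sum>f\<in>g ` {..<N}. c f * f z)" for z
    by (subst sum.image_gen [where g = g]) (auto simp: c_def sum_distrib_right intro!: sum.cong)
  then show ?thesis
    unfolding lin_span_def by (intro CollectI exI [of _ "g ` {..<N}"] exI [of _ c]) auto
qed

lemma lin_span_shifts_factor:
  assumes "g \<in> lin_span {\<lambda>z. z ^ k * f z | k :: nat. True}"
  shows "\<exists>p. p holomorphic_on UNIV \<and> g = (\<lambda>z. p z * f z)"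
proof -
  obtain T c where g: "g = (\<lambda>z. \<Sum>h\<in>T. c h * h z)" and
    T: "T \<subseteq> {\<lambda>z. z ^ k * f z | k :: nat. True}"
    using assms by (auto simp: lin_span_def)
  then have "\<forall>h\<in>T. \<exists>k. h = (\<lambda>z. z ^ k * f z)"
    by blast
  then obtain \<kappa> where \<kappa>: "\<And>h. h \<in> T \<Longrightarrow> h = (\<lambda>z. z ^ \<kappa> h * f z)"
    by metis
  have "c h * h z = c h * z ^ \<kappa> h * f z" if "h \<in> T" for h z
    using fun_cong [OF \<kappa> [OF that], of z] by simp
  then have "g = (\<lambda>z. (\<Sum>h\<in>T. c h * z ^ \<kappa> h) * f z)"
    unfolding g sum_distrib_right by (auto intro!: sum.cong)
  moreover have "(\<lambda>z. \<Sum>h\<in>T. c h * z ^ \<kappa> h) holomorphic_on UNIV"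
    by (intro holomorphic_intros)
  ultimately show ?thesis by blast
qed

lemma mean_square_times_hinf:
  assumes "f holomorphic_on ball 0 1" "0 < r" "r < 1"
  shows "mean_square (\<lambda>z. happ h z * f z) r \<le> (norm h)\<^sup>2 * mean_square f r"
proof -
  have "(norm (happ h z * f z))\<^sup>2 \<le> 0 + (norm h)\<^sup>2 * (norm (f z))\<^sup>2" for z
    by (simp add: norm_mult power_mult_distrib mult_right_mono power_mono norm_happ_le)
  from mean_square_affine_bound [OF _ assms(1-3) this] show ?thesis
    using assms(1) by (simp add: holomorphic_intros happ_holomorphic)
qed

lemma mean_square_cong:
  assumes "\<And>z. z \<in> ball 0 1 \<Longrightarrow> f z = g z" "0 < r" "r < 1"
  shows "mean_square f r = mean_square g r"
proof -
  have "f (of_real r * cis t) = g (of_real r * cis t)" for t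
    using assms by (simp add: norm_mult)
  then show ?thesis
    by (simp add: mean_square_def)
qed

text \<open>
  If \<open>k\<close> is the inverse of \<open>h\<close>, then \<open>g = h * (k * g)\<close>. A polynomial close to \<open>k * g\<close>, multiplied
  by the bounded function \<open>h\<close>, is close to \<open>g\<close>.
\<close>

lemma outer_if_unit:
  assumes "h dvd 1"
  shows "outer h"
  unfolding outer_def
proof (intro equalityI subsetI)
  fix g assume g: "g \<in> H2"
  obtain k where "1 = h * k"
    using assms by (auto elim: dvdE)
  then have hk: "happ h z * happ k z = 1" if "z \<in> ball 0 1" for z
    using happ_one [OF that] by (metis happ_times)
  have gh: "g holomorphic_on ball 0 1" and "bdd_above (mean_square g ` {0<..<1})"
    using g by (auto simp: H2_def)
  then obtain B where B: "\<And>r. 0 < r \<Longrightarrow> r < 1 \<Longrightarrow> mean_square g r \<le> B"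
    unfolding bdd_above_def by (metis greaterThanLessThan_iff imageI)
  define q where "q = (\<lambda>z. happ k z * g z)"
  have qh: "q holomorphic_on ball 0 1"
    unfolding q_def by (intro holomorphic_intros happ_holomorphic gh)
  have "mean_square q r \<le> (norm k)\<^sup>2 * B" if "0 < r" "r < 1" for r
  proof -
    have "mean_square q r \<le> (norm k)\<^sup>2 * mean_square g r"
      unfolding q_def by (rule mean_square_times_hinf [OF gh that])
    also have "\<dots> \<le> (norm k)\<^sup>2 * B"
      using B [OF that] by (simp add: mult_left_mono)
    finally show ?thesis .
  qed
  then have qH: "q \<in> H2"
    using qh unfolding H2_def by (auto intro!: bdd_aboveI)
  show "g \<in> H2_closure (lin_span {\<lambda>z. z ^ k * happ h z | k :: nat. True})"
    unfolding H2_closure_def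
  proof (intro CollectI conjI allI impI g)
    fix \<epsilon> :: real assume \<epsilon>: "0 < \<epsilon>"
    define \<delta> where "\<delta> = \<epsilon>\<^sup>2 / ((norm h)\<^sup>2 + 1) / 2"
    have nh: "(norm h)\<^sup>2 + 1 > 0"
      by (simp add: add_nonneg_pos)
    then have \<delta>: "\<delta> > 0"
      using \<epsilon> by (simp add: \<delta>_def)
    have "(norm h)\<^sup>2 * \<delta> \<le> ((norm h)\<^sup>2 + 1) * \<delta>"
      using \<delta> by simp
    also have "\<dots> = \<epsilon>\<^sup>2 / 2"
      using nh by (simp add: \<delta>_def field_simps)
    also have "\<dots> < \<epsilon>\<^sup>2"
      using \<epsilon> by simp
    finally have small: "(norm h)\<^sup>2 * \<delta> < \<epsilon>\<^sup>2" .
    obtain a N where aN: "\<And>r. 0 < r \<Longrightarrow> r < 1 \<Longrightarrow>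
        mean_square (\<lambda>z. q z - (\<Sum>n<N. a n * z ^ n)) r \<le> \<delta>"
      using H2_polynomials_dense [OF qH \<delta>] by blast
    let ?p = "\<lambda>z. \<Sum>n<N. a n * (z ^ n * happ h z)"
    have "H2_norm (\<lambda>z. g z - ?p z) < \<epsilon>"
    proof (rule H2_norm_less [OF _ small \<epsilon>])
      fix r :: real assume r: "0 < r" "r < 1"
      have eq: "g z - ?p z = happ h z * (q z - (\<Sum>n<N. a n * z ^ n))" if "z \<in> ball 0 1" for z
      proof -
        have "happ h z * (\<Sum>n<N. a n * z ^ n) = ?p z"
          by (simp add: sum_distrib_left mult_ac)
        moreover have "happ h z * q z = g z"
          using hk [OF that] by (simp add: q_def flip: mult.assoc)
        ultimately show ?thesis
          by (simp add: right_diff_distrib)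
      qed
      have "mean_square (\<lambda>z. g z - ?p z) r =
          mean_square (\<lambda>z. happ h z * (q z - (\<Sum>n<N. a n * z ^ n))) r"
        by (rule mean_square_cong [OF eq r])
      also have "\<dots> \<le> (norm h)\<^sup>2 * mean_square (\<lambda>z. q z - (\<Sum>n<N. a n * z ^ n)) r"
        by (rule mean_square_times_hinf [OF _ r]) (intro holomorphic_intros qh)
      also have "\<dots> \<le> (norm h)\<^sup>2 * \<delta>"
        using aN [OF r] by (simp add: mult_left_mono)
      finally show "mean_square (\<lambda>z. g z - ?p z) r \<le> (norm h)\<^sup>2 * \<delta>" .
    qed
    moreover have "?p \<in> lin_span {\<lambda>z. z ^ k * happ h z | k :: nat. True}"
      by (rule lin_span_family_sum)
    ultimately show "\<exists>f\<in>lin_span {\<lambda>z. z ^ k * happ h z | k :: nat. True}.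
        H2_norm (\<lambda>z. g z - f z) < \<epsilon>"
      by (rule bexI)
  qed
qed (auto simp: H2_closure_def)

text \<open>
  The elements of the span are \<open>F\<close> times a polynomial, recorded as an entire function \<open>p\<close>; its
  continuity up to the circle is what makes boundary limits of \<open>p * G\<close> accessible for inner \<open>G\<close>.
\<close>

lemma outer_approx:
  assumes "outer F" "0 < \<epsilon>"
  shows "\<exists>p. p holomorphic_on UNIV \<and> (\<forall>r. 0 < r \<longrightarrow> r < 1 \<longrightarrow>
    mean_square (\<lambda>z. happ g z - p z * happ F z) r \<le> \<epsilon>\<^sup>2)"
proof -
  have "happ g \<in> H2"
    by (rule bounded_imp_H2 [OF happ_holomorphic happ_bounded])
  then have "happ g \<in> H2_closure (lin_span {\<lambda>z. z ^ k * happ F z | k :: nat. True})"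
    using assms(1) by (simp add: outer_def)
  then obtain f where f: "f \<in> lin_span {\<lambda>z. z ^ k * happ F z | k :: nat. True}"
    and small: "H2_norm (\<lambda>z. happ g z - f z) < \<epsilon>"
    using assms(2) unfolding H2_closure_def by blast
  obtain p where p: "p holomorphic_on UNIV" and fp: "f = (\<lambda>z. p z * happ F z)"
    using lin_span_shifts_factor [OF f] by blast
  have ph: "p holomorphic_on ball 0 1"
    using p by (rule holomorphic_on_subset) simp
  have "compact (p ` cball 0 1)"
    by (intro compact_continuous_image holomorphic_on_imp_continuous_on
        holomorphic_on_subset [OF p]) auto
  then have "bounded (p ` ball 0 1)"
    using bounded_subset [OF compact_imp_bounded] ball_subset_cball by (metis image_mono)
  then have H: "(\<lambda>z. happ g z - p z * happ F z) \<in> H2"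
    by (intro bounded_imp_H2 bounded_minus_comp bounded_image_mult happ_bounded
        holomorphic_intros happ_holomorphic ph)
  have "mean_square (\<lambda>z. happ g z - p z * happ F z) r \<le> \<epsilon>\<^sup>2" if r: "0 < r" "r < 1" for r
  proof -
    have "mean_square (\<lambda>z. happ g z - p z * happ F z) r \<le>
        (H2_norm (\<lambda>z. happ g z - p z * happ F z))\<^sup>2"
      by (rule mean_square_le_H2_norm [OF H r])
    also have "\<dots> \<le> \<epsilon>\<^sup>2"
      using small H2_norm_nonneg [OF H] by (simp add: fp power_mono)
    finally show ?thesis .
  qed
  with p show ?thesis by blast
qed

section \<open>Uniqueness of the inner-outer factorization with invertible outer part\<close>

definition radius :: "nat \<Rightarrow> real"
  where "radius k = 1 - 1 / (real k + 2)"

lemma radius_bounds: "0 < radius k" "radius k < 1"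
  by (auto simp: radius_def field_simps)

lemma radius_tendsto: "radius \<longlonglongrightarrow> 1"
  unfolding radius_def by real_asymp

lemma radius_at_left: "filterlim radius (at_left 1) sequentially"
  unfolding filterlim_at using radius_tendsto radius_bounds
  by (auto intro!: always_eventually simp: less_imp_neq)

text \<open>
  Multiplication by an inner function preserves the boundary square mean, by dominated convergence.
  As \<open>p\<close> is continuous up to the circle, the radial limits of the product have modulus \<open>norm (p (cis t))\<close>.
\<close>

lemma inner_mean_square_tendsto:
  assumes G: "inner_fun G" and p: "continuous_on UNIV p"
  shows "(\<lambda>k. mean_square (\<lambda>z. p z * happ G z) (radius k)) \<longlonglongrightarrow>
    (1 / (2 * pi)) * integral {0..2 * pi} (\<lambda>t. (norm (p (cis t)))\<^sup>2)"
proof -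
  let ?L = "lebesgue_on {0..2 * pi}"
  have "compact (p ` cball 0 1)"
    by (intro compact_continuous_image continuous_on_subset [OF p]) auto
  then obtain C where C: "\<And>z. z \<in> cball 0 1 \<Longrightarrow> norm (p z) \<le> C"
    using compact_imp_bounded [of "p ` cball 0 1"] unfolding bounded_iff by blast
  define s where "s k t = (norm (p (of_real (radius k) * cis t) * happ G (of_real (radius k) * cis t)))\<^sup>2"
    for k t
  have cont: "continuous_on {0..2 * pi} (s k)" for k
    unfolding s_def using radius_bounds [of k]
    by (intro continuous_intros continuous_on_compose2 [OF p]
        continuous_on_compose2 [OF holomorphic_on_imp_continuous_on [OF happ_holomorphic]])
      (auto simp: norm_mult)
  have contl: "continuous_on {0..2 * pi} (\<lambda>t. (norm (p (cis t)))\<^sup>2)"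
    by (intro continuous_intros continuous_on_compose2 [OF p]) auto
  have int: "integrable ?L (s k)" for k
    by (rule continuous_imp_integrable_real [OF cont])
  have intl: "integrable ?L (\<lambda>t. (norm (p (cis t)))\<^sup>2)"
    by (rule continuous_imp_integrable_real [OF contl])
  have "(\<lambda>k. integral\<^sup>L ?L (s k)) \<longlonglongrightarrow> integral\<^sup>L ?L (\<lambda>t. (norm (p (cis t)))\<^sup>2)"
  proof (rule integral_dominated_convergence)
    show "s k \<in> borel_measurable ?L" for k
      using int by (rule borel_measurable_integrable)
    show "(\<lambda>t. (norm (p (cis t)))\<^sup>2) \<in> borel_measurable ?L"
      using intl by (rule borel_measurable_integrable)
    show "integrable ?L (\<lambda>t. (C * norm G)\<^sup>2)"
      by (rule continuous_imp_integrable_real) simp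
    show "AE t in ?L. norm (s k t) \<le> (C * norm G)\<^sup>2" for k
    proof (rule AE_I2)
      fix t
      have "norm (p (of_real (radius k) * cis t) * happ G (of_real (radius k) * cis t)) \<le> C * norm G"
        using C [of "of_real (radius k) * cis t"] radius_bounds [of k]
        by (auto simp: norm_mult intro!: mult_mono' norm_happ_le)
      then show "norm (s k t) \<le> (C * norm G)\<^sup>2"
        by (simp add: s_def power_mono)
    qed
    show "AE t in ?L. (\<lambda>k. s k t) \<longlonglongrightarrow> (norm (p (cis t)))\<^sup>2"
      using G unfolding inner_fun_def
    proof eventually_elim
      fix t assume "\<exists>l. norm l = 1 \<and> ((\<lambda>r. happ G (of_real r * cis t)) \<longlongrightarrow> l) (at_left 1)"
      then obtain l where l: "norm l = 1" "((\<lambda>r. happ G (of_real r * cis t)) \<longlongrightarrow> l) (at_left 1)"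
        by blast
      have 1: "(\<lambda>k. happ G (of_real (radius k) * cis t)) \<longlonglongrightarrow> l"
        using filterlim_compose [OF l(2) radius_at_left] .
      have "(\<lambda>k. of_real (radius k) * cis t) \<longlonglongrightarrow> of_real 1 * cis t"
        by (intro tendsto_intros radius_tendsto)
      then have 2: "(\<lambda>k. p (of_real (radius k) * cis t)) \<longlonglongrightarrow> p (of_real 1 * cis t)"
        by (rule continuous_on_tendsto_compose [OF p]) auto
      have "(\<lambda>k. s k t) \<longlonglongrightarrow> (norm (p (of_real 1 * cis t) * l))\<^sup>2"
        unfolding s_def by (intro tendsto_intros 1 2)
      then show "(\<lambda>k. s k t) \<longlonglongrightarrow> (norm (p (cis t)))\<^sup>2"
        by (simp add: norm_mult l)
    qed
  qed
  then have "(\<lambda>k. integral {0..2 * pi} (s k)) \<longlonglongrightarrow> integral {0..2 * pi} (\<lambda>t. (norm (p (cis t)))\<^sup>2)"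
    by (simp add: lebesgue_integral_eq_integral int intl)
  then show ?thesis
    unfolding mean_square_def s_def by (rule tendsto_mult_left)
qed

lemma inner_fun_one: "inner_fun 1"
  unfolding inner_fun_def
proof (rule AE_I2, intro exI conjI)
  fix t
  have "\<forall>\<^sub>F r in at_left 1. happ 1 (of_real r * cis t) = 1"
    using eventually_at_left_real [of 0 "1::real"]
    by (auto elim!: eventually_mono simp: happ_one norm_mult)
  then show "((\<lambda>r. happ 1 (of_real r * cis t)) \<longlongrightarrow> 1) (at_left 1)"
    by (simp add: tendsto_eventually)
qed simp

text \<open>
  The squared moduli of the Taylor coefficients of an inner function sum to at most 1, and here the
  constant term already uses this up.
\<close>

lemma inner_modulus_at_0_imp_constant:
  assumes G: "inner_fun G" and 1: "1 \<le> norm (happ G 0)"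
  shows "\<exists>c. norm c = 1 \<and> (\<forall>z\<in>ball 0 1. happ G z = c)"
proof -
  define a where "a n = (deriv ^^ n) (happ G) 0 / fact n" for n
  have sums: "(\<lambda>n. a n * z ^ n) sums happ G z" if "z \<in> ball 0 1" for z
    unfolding a_def by (rule taylor_sums [OF happ_holomorphic that])
  have a0: "a 0 = happ G 0"
    by (simp add: a_def)
  have lim: "(\<lambda>k. mean_square (happ G) (radius k)) \<longlonglongrightarrow> 1"
    using inner_mean_square_tendsto [OF G, of "\<lambda>_. 1"] by simp
  have fin: "(\<Sum>n\<in>S. (norm (a n))\<^sup>2) \<le> 1" if "finite S" for S
  proof (rule LIMSEQ_le [OF _ lim])
    have "(\<lambda>k. \<Sum>n\<in>S. (norm (a n))\<^sup>2 * radius k ^ (2 * n)) \<longlonglongrightarrow> (\<Sum>n\<in>S. (norm (a n))\<^sup>2 * 1 ^ (2 * n))"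
      by (intro tendsto_intros radius_tendsto)
    then show "(\<lambda>k. \<Sum>n\<in>S. (norm (a n))\<^sup>2 * radius k ^ (2 * n)) \<longlonglongrightarrow> (\<Sum>n\<in>S. (norm (a n))\<^sup>2)"
      by simp
    have "(\<Sum>n\<in>S. (norm (a n))\<^sup>2 * radius k ^ (2 * n)) \<le> mean_square (happ G) (radius k)" for k
    proof -
      have s: "(\<lambda>n. (norm (a n))\<^sup>2 * radius k ^ (2 * n)) sums mean_square (happ G) (radius k)"
        by (rule mean_square_sums [OF sums radius_bounds])
      show ?thesis
        unfolding sums_unique [OF s]
        by (rule sum_le_suminf [OF sums_summable [OF s] that])
          (auto intro!: mult_nonneg_nonneg zero_le_power less_imp_le radius_bounds)
    qed
    then show "\<exists>N. \<forall>k\<ge>N. (\<Sum>n\<in>S. (norm (a n))\<^sup>2 * radius k ^ (2 * n)) \<le> mean_square (happ G) (radius k)"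
      by blast
  qed
  have "1 \<le> (norm (a 0))\<^sup>2"
    using 1 by (simp add: a0)
  then have eq1: "(norm (a 0))\<^sup>2 = 1"
    using fin [of "{0}"] by simp
  have "a n = 0" if "n > 0" for n
    using fin [of "{0, n}"] eq1 that by simp
  then have "(\<lambda>n. a n * z ^ n) = (\<lambda>n. if n = 0 then a n else 0)" for z
    by auto
  then have "happ G z = a 0" if "z \<in> ball 0 1" for z
    using sums_unique2 [OF sums [OF that]] sums_single [of 0 a] by metis
  moreover have "norm (a 0) = 1"
    using eq1 norm_ge_zero [of "a 0"] by (auto simp: power2_eq_1_iff simp del: norm_ge_zero)
  ultimately show ?thesis by blast
qed

text \<open>
  A function that is inner and, up to an invertible factor, outer has modulus at least 1 at the origin.
  Outerness gives \<open>p\<close> with \<open>p * G\<close> within \<open>\<delta>\<close> of \<open>1\<close> in square mean. As \<open>G\<close> is inner, \<open>p\<close> has the same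
  boundary square mean as \<open>p * G\<close>, hence \<open>norm (p 0) \<le> 1 + \<delta>\<close>, while \<open>p 0 * G 0\<close> is within \<open>\<delta>\<close> of \<open>1\<close>.
  If \<open>norm (G 0) < 1\<close>, a small \<open>\<delta>\<close> makes this impossible.
\<close>

lemma inner_and_outer_imp_constant:
  assumes G: "inner_fun G" and F: "outer F" and GF: "G = F * k" and hk: "h * k = 1"
  shows "\<exists>c. norm c = 1 \<and> (\<forall>z\<in>ball 0 1. happ G z = c)"
proof (rule inner_modulus_at_0_imp_constant [OF G], rule ccontr)
  assume "\<not> 1 \<le> norm (happ G 0)"
  define g where "g = norm (happ G 0)"
  have g: "0 \<le> g" "g < 1"
    using \<open>\<not> 1 \<le> norm (happ G 0)\<close> by (auto simp: g_def)
  \<comment> \<open>small enough that \<open>(1 - \<delta>) / (1 + \<delta>) > g\<close>\<close>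
  define \<delta> where "\<delta> = (1 - g) / 3"
  have \<delta>: "0 < \<delta>"
    using g by (simp add: \<delta>_def)
  have "k \<noteq> 0"
    using hk by auto
  then have "0 < \<delta> / norm k"
    using \<delta> by simp
  from outer_approx [OF F this, of h] obtain p where p: "p holomorphic_on UNIV" and
    hp: "\<And>r. 0 < r \<Longrightarrow> r < 1 \<Longrightarrow> mean_square (\<lambda>z. happ h z - p z * happ F z) r \<le> (\<delta> / norm k)\<^sup>2"
    by blast
  have ph: "p holomorphic_on ball 0 1"
    using p by (rule holomorphic_on_subset) simp
  let ?e = "\<lambda>z. 1 - p z * happ G z"
  have e: "mean_square ?e r \<le> \<delta>\<^sup>2" if r: "0 < r" "r < 1" for r
  proof -
    have "?e z = happ k z * (happ h z - p z * happ F z)" if "z \<in> ball 0 1" for z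
      using happ_one [OF that] unfolding hk [symmetric] GF by (simp add: algebra_simps)
    then have "mean_square ?e r = mean_square (\<lambda>z. happ k z * (happ h z - p z * happ F z)) r"
      by (rule mean_square_cong [OF _ r])
    also have "\<dots> \<le> (norm k)\<^sup>2 * mean_square (\<lambda>z. happ h z - p z * happ F z) r"
      by (rule mean_square_times_hinf [OF _ r]) (intro holomorphic_intros happ_holomorphic ph)
    also have "\<dots> \<le> (norm k)\<^sup>2 * (\<delta> / norm k)\<^sup>2"
      by (rule mult_left_mono [OF hp [OF r]]) simp
    also have "\<dots> = \<delta>\<^sup>2"
      using \<open>k \<noteq> 0\<close> by (simp add: power_divide)
    finally show ?thesis .
  qed
  have eh: "?e holomorphic_on ball 0 1" and pGh: "(\<lambda>z. p z * happ G z) holomorphic_on ball 0 1"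
    by (intro holomorphic_intros happ_holomorphic ph)+
  have pG: "mean_square (\<lambda>z. p z * happ G z) r \<le> (1 + \<delta>)\<^sup>2" if r: "0 < r" "r < 1" for r
  proof -
    \<comment> \<open>the weights are those for which the square means add up to \<open>(1 + \<delta>)\<^sup>2\<close>\<close>
    have "(norm (p z * happ G z))\<^sup>2 \<le> (1 + \<delta>) + (1 + 1 / \<delta>) * (norm (?e z))\<^sup>2" for z
    proof -
      have "norm (p z * happ G z) \<le> 1 + norm (?e z)"
        using norm_triangle_ineq4 [of 1 "?e z"] by simp
      then have "(norm (p z * happ G z))\<^sup>2 \<le> (1 + norm (?e z))\<^sup>2"
        by (rule power_mono) simp
      also have "\<dots> + (\<delta> - norm (?e z))\<^sup>2 / \<delta> = (1 + \<delta>) + (1 + 1 / \<delta>) * (norm (?e z))\<^sup>2"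
        using \<delta> by (simp add: field_simps power2_eq_square)
      finally show ?thesis
        using \<delta> by (smt (verit) divide_nonneg_pos zero_le_power2)
    qed
    then have "mean_square (\<lambda>z. p z * happ G z) r \<le> (1 + \<delta>) + (1 + 1 / \<delta>) * mean_square ?e r"
      by (intro mean_square_affine_bound pGh eh r)
    also have "\<dots> \<le> (1 + \<delta>) + (1 + 1 / \<delta>) * \<delta>\<^sup>2"
      using e [OF r] \<delta> by (intro add_left_mono mult_left_mono) auto
    also have "\<dots> = (1 + \<delta>)\<^sup>2"
      using \<delta> by (simp add: field_simps power2_eq_square)
    finally show ?thesis .
  qed
  let ?A = "(1 / (2 * pi)) * integral {0..2 * pi} (\<lambda>t. (norm (p (cis t)))\<^sup>2)"
  have pc: "continuous_on UNIV p"
    by (rule holomorphic_on_imp_continuous_on [OF p])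
  have "?A \<le> (1 + \<delta>)\<^sup>2"
    by (rule LIMSEQ_le_const2 [OF inner_mean_square_tendsto [OF G pc]])
      (use pG radius_bounds in blast)
  moreover have "(norm (p 0))\<^sup>2 \<le> ?A"
  proof (rule LIMSEQ_le_const [OF inner_mean_square_tendsto [OF inner_fun_one pc]])
    have "mean_square (\<lambda>z. p z * happ 1 z) r = mean_square p r" if "0 < r" "r < 1" for r
      by (rule mean_square_cong [OF _ that]) (simp add: happ_one)
    then show "\<exists>N. \<forall>k\<ge>N. (norm (p 0))\<^sup>2 \<le> mean_square (\<lambda>z. p z * happ 1 z) (radius k)"
      using norm_value_at_0_le_mean_square [OF ph radius_bounds] radius_bounds by simp
  qed
  ultimately have "(norm (p 0))\<^sup>2 \<le> (1 + \<delta>)\<^sup>2"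
    by simp
  then have p0: "norm (p 0) \<le> 1 + \<delta>"
    using \<delta> by (simp add: power2_le_iff_abs_le)
  have "(norm (?e 0))\<^sup>2 \<le> \<delta>\<^sup>2"
    using norm_value_at_0_le_mean_square [OF eh, of "1/2"] e [of "1/2"] by simp
  then have "norm (?e 0) \<le> \<delta>"
    using \<delta> by (simp add: power2_le_iff_abs_le)
  then have "1 - \<delta> \<le> norm (p 0 * happ G 0)"
    using norm_triangle_ineq [of "?e 0" "p 0 * happ G 0"] by simp
  also have "\<dots> \<le> (1 + \<delta>) * g"
    using p0 g by (simp add: norm_mult g_def mult_right_mono)
  finally have "(1 - g) * (2 - g) \<le> 0"
    by (simp add: \<delta>_def field_simps)
  then show False
    using g by (simp add: mult_le_0_iff)
qed

lemma deriv_scaled_happ: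
  assumes "\<And>z. z \<in> ball 0 1 \<Longrightarrow> happ u z = c * happ v z"
  shows "(deriv ^^ n) (happ u) 0 = c * (deriv ^^ n) (happ v) 0"
proof -
  have "happ u = (\<lambda>z. c * happ v z)"
    using assms happ_outside by (metis mult_zero_right)
  then show ?thesis
    using higher_deriv_cmult [OF happ_holomorphic, of 0] by simp
qed

lemma inner_quotient:
  assumes "inner_fun u" "inner_fun v" "u = v * G"
  shows "inner_fun G"
  using assms(1,2) unfolding inner_fun_def
proof eventually_elim
  fix t
  assume "\<exists>l. norm l = 1 \<and> ((\<lambda>r. happ u (of_real r * cis t)) \<longlongrightarrow> l) (at_left 1)"
    and "\<exists>l. norm l = 1 \<and> ((\<lambda>r. happ v (of_real r * cis t)) \<longlongrightarrow> l) (at_left 1)"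
  then obtain l m where l: "norm l = 1" "((\<lambda>r. happ u (of_real r * cis t)) \<longlongrightarrow> l) (at_left 1)"
    and m: "norm m = 1" "((\<lambda>r. happ v (of_real r * cis t)) \<longlongrightarrow> m) (at_left 1)"
    by blast
  have "m \<noteq> 0"
    using m(1) by auto
  have "\<forall>\<^sub>F r in at_left 1. happ v (of_real r * cis t) \<noteq> 0"
    using tendsto_imp_eventually_ne [OF m(2) \<open>m \<noteq> 0\<close>] .
  then have ev: "\<forall>\<^sub>F r in at_left 1. happ u (of_real r * cis t) / happ v (of_real r * cis t) =
      happ G (of_real r * cis t)"
    by eventually_elim (simp add: assms(3))
  have "((\<lambda>r. happ u (of_real r * cis t) / happ v (of_real r * cis t)) \<longlongrightarrow> l / m) (at_left 1)"
    by (intro tendsto_divide l m \<open>m \<noteq> 0\<close>)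
  with ev have "((\<lambda>r. happ G (of_real r * cis t)) \<longlongrightarrow> l / m) (at_left 1)"
    by (rule Lim_transform_eventually [rotated])
  then show "\<exists>l. norm l = 1 \<and> ((\<lambda>r. happ G (of_real r * cis t)) \<longlongrightarrow> l) (at_left 1)"
    using l m by (intro exI [of _ "l / m"]) (simp add: norm_divide)
qed

lemma unimodular_positive_ratio:
  fixes x y c :: complex
  assumes "x = c * y" "norm c = 1" "x \<in> \<real>" "0 < Re x" "y \<in> \<real>" "0 < Re y"
  shows "c = 1"
proof -
  obtain s t where st: "x = of_real s" "y = of_real t" "0 < s" "0 < t"
    using assms(3-6) by (auto elim!: Reals_cases)
  have c: "c = of_real (s / t)"
    using assms(1) st by (simp add: field_simps)
  then show ?thesis
    using assms(2) st by (simp add: norm_divide)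
qed

text \<open>
  Uniqueness of the factorization when one outer factor \<open>h\<close> is invertible: if also \<open>u * h = v * F\<close>,
  then \<open>u / v = F / h\<close> is inner, and it is outer up to the factor \<open>1 / h\<close>. So it is a unimodular
  constant, which the normalization forces to be 1.
\<close>

lemma inner_outer_unit:
  assumes u: "normalized_inner u" and h: "h dvd 1"
  shows "inner_outer (u * h) = (u, h)"
  unfolding inner_outer_def
proof (rule the_equality)
  show "case (u, h) of (v, F) \<Rightarrow> normalized_inner v \<and> outer F \<and> u * h = v * F"
    using u outer_if_unit [OF h] by simp
next
  fix x assume x: "case x of (v, F) \<Rightarrow> normalized_inner v \<and> outer F \<and> u * h = v * F"
  obtain v F where vF: "x = (v, F)" by fastforce
  with x have v: "normalized_inner v" and F: "outer F" and eq: "u * h = v * F"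
    by auto
  obtain k where hk: "h * k = 1"
    using h by (metis dvdE)
  have ug: "u = v * (F * k)"
    using eq hk by (metis mult.assoc mult.right_neutral)
  have "inner_fun (F * k)"
    using inner_quotient [OF _ _ ug] u v by (simp add: normalized_inner_def)
  from inner_and_outer_imp_constant [OF this F refl hk] obtain c where
    c: "norm c = 1" "\<And>z. z \<in> ball 0 1 \<Longrightarrow> happ (F * k) z = c"
    by blast
  have "happ u z = c * happ v z" if "z \<in> ball 0 1" for z
    using c(2) [OF that] unfolding ug by simp
  note d = deriv_scaled_happ [OF this]
  have M: "Mul0 u = Mul0 v"
    unfolding Mul0_def using d c(1) by (metis mult_eq_0_iff norm_zero zero_neq_one)
  have "c = 1"
    by (rule unimodular_positive_ratio [OF d [of "Mul0 v"] c(1)])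
      (use u v in \<open>auto simp: normalized_inner_def M\<close>)
  then have "F * k = 1"
    using c(2) by (intro hinf_eqI) (simp add: happ_one)
  then have "v = u" "F = h"
    using ug hk by (simp, metis mult.commute mult.left_commute mult.right_neutral)
  then show "x = (u, h)"
    by (simp add: vF)
qed

section \<open>Euler's infinite product\<close>

text \<open>
  With this nome, multiplication of the argument by the nome corresponds to a translation by \<open>- 2\<close>
  in the logarithmic coordinate.
\<close>

definition nome :: real
  where "nome = exp (- 2)"

lemma nome_bounds: "0 < nome" "nome < 1"
  by (auto simp: nome_def)

primrec euler_coeff :: "nat \<Rightarrow> real"
  where
    "euler_coeff 0 = 1"
  | "euler_coeff (Suc n) = - (nome ^ n / (1 - nome ^ Suc n)) * euler_coeff n"

text \<open>
  This is Euler's expansion of the product of all \<open>1 - nome ^ j * x\<close>. The power series makes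
  holomorphy and the reality of the coefficients immediate; the zeros are then recovered from the
  functional equation alone.
\<close>

definition euler_fun :: "complex \<Rightarrow> complex"
  where "euler_fun x = (\<Sum>n. of_real (euler_coeff n) * x ^ n)"

lemma summable_euler: "summable (\<lambda>n. of_real (euler_coeff n) * x ^ n :: complex)"
proof -
  have "(\<lambda>n. nome ^ n / (1 - nome) * norm x) \<longlonglongrightarrow> 0 / (1 - nome) * norm x"
    using nome_bounds by (intro tendsto_intros LIMSEQ_power_zero) auto
  then have "\<forall>\<^sub>F n in sequentially. nome ^ n / (1 - nome) * norm x < 1 / 2"
    by (rule order_tendstoD) simp
  then obtain N where N: "\<And>n. N \<le> n \<Longrightarrow> nome ^ n / (1 - nome) * norm x < 1 / 2"
    by (auto simp: eventually_sequentially)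
  show ?thesis
  proof (rule summable_ratio_test [of "1 / 2" N])
    fix n assume n: "N \<le> n"
    have "nome ^ Suc n \<le> nome"
      using nome_bounds by (simp add: mult_left_le power_le_one)
    moreover have "nome ^ Suc n < 1"
      using nome_bounds by (intro power_Suc_less_one)
    ultimately have "nome ^ n / (1 - nome ^ Suc n) * norm x \<le> nome ^ n / (1 - nome) * norm x"
      using nome_bounds by (intro mult_right_mono divide_left_mono mult_pos_pos) auto
    also have "\<dots> \<le> 1 / 2"
      using N [OF n] by simp
    finally have le: "nome ^ n / (1 - nome ^ Suc n) * norm x \<le> 1 / 2" .
    have "nome ^ Suc n < 1"
      using nome_bounds by (intro power_Suc_less_one)
    then have "norm (of_real (euler_coeff (Suc n)) * x ^ Suc n) =
        (nome ^ n / (1 - nome ^ Suc n) * norm x) * norm (of_real (euler_coeff n) * x ^ n)"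
      using nome_bounds by (simp add: norm_mult norm_power abs_mult del: of_real_mult of_real_power
          of_real_divide of_real_minus of_real_diff)
    also have "\<dots> \<le> 1 / 2 * norm (of_real (euler_coeff n) * x ^ n)"
      by (rule mult_right_mono [OF le]) simp
    finally show "norm (of_real (euler_coeff (Suc n)) * x ^ Suc n) \<le>
        1 / 2 * norm (of_real (euler_coeff n) * x ^ n)" .
  qed simp
qed

lemma euler_fun_sums: "(\<lambda>n. of_real (euler_coeff n) * x ^ n) sums euler_fun x"
  unfolding euler_fun_def by (rule summable_sums [OF summable_euler])

lemma euler_fun_0 [simp]: "euler_fun 0 = 1"
  using powser_zero [of "\<lambda>n. of_real (euler_coeff n) :: complex"] by (simp add: euler_fun_def)

lemma euler_fun_holomorphic: "euler_fun holomorphic_on S"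
  unfolding euler_fun_def holomorphic_on_def field_differentiable_def
  using termdiffs_strong_converges_everywhere [OF summable_euler]
  by (blast intro: has_field_derivative_at_within)

lemma euler_fun_cnj: "euler_fun (cnj x) = cnj (euler_fun x)"
proof -
  have "(\<lambda>n. cnj (of_real (euler_coeff n) * x ^ n)) sums cnj (euler_fun x)"
    using euler_fun_sums by (simp only: sums_cnj)
  then have "(\<lambda>n. of_real (euler_coeff n) * cnj x ^ n) sums cnj (euler_fun x)"
    by simp
  with euler_fun_sums show ?thesis
    by (rule sums_unique2)
qed

lemma euler_fun_scale: "euler_fun x = (1 - x) * euler_fun (of_real nome * x)"
proof -
  define d where "d n = of_real (euler_coeff n) * x ^ n - of_real (euler_coeff n) * (of_real nome * x) ^ n" for n
  have 1: "d sums (euler_fun x - euler_fun (of_real nome * x))"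
    unfolding d_def by (intro sums_diff euler_fun_sums)
  have "d (Suc n) = - x * (of_real (euler_coeff n) * (of_real nome * x) ^ n)" for n
  proof -
    have "euler_coeff (Suc n) * (1 - nome ^ Suc n) = - (nome ^ n) * euler_coeff n"
      using power_Suc_less_one [OF nome_bounds, of n] by simp
    then have "of_real (euler_coeff (Suc n) * (1 - nome ^ Suc n)) =
        (of_real (- (nome ^ n) * euler_coeff n) :: complex)"
      by (rule arg_cong)
    moreover have "d (Suc n) = of_real (euler_coeff (Suc n) * (1 - nome ^ Suc n)) * x ^ Suc n"
      unfolding d_def by (simp add: power_mult_distrib algebra_simps del: euler_coeff.simps)
    ultimately show ?thesis
      by (simp add: power_mult_distrib mult_ac del: euler_coeff.simps)
  qed
  moreover have "(\<lambda>n. - x * (of_real (euler_coeff n) * (of_real nome * x) ^ n)) sums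
      (- x * euler_fun (of_real nome * x))"
    by (intro sums_mult euler_fun_sums)
  ultimately have "(\<lambda>n. d (Suc n)) sums (- x * euler_fun (of_real nome * x))"
    by simp
  then have "d sums (- x * euler_fun (of_real nome * x) + d 0)"
    by (simp only: sums_Suc_iff add_diff_cancel_right')
  with 1 have "euler_fun x - euler_fun (of_real nome * x) = - x * euler_fun (of_real nome * x) + d 0"
    by (rule sums_unique2)
  then show ?thesis
    by (simp add: d_def algebra_simps)
qed

text \<open>
  If no factor \<open>1 - nome ^ j * x\<close> vanished, the functional equation would carry the zero \<open>x\<close> to every
  \<open>nome ^ j * x\<close>, contradicting \<open>euler_fun 0 = 1\<close> by continuity.
\<close>

lemma euler_fun_zero:
  assumes "euler_fun x = 0"
  shows "\<exists>j. of_real (nome ^ j) * x = 1"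
proof (rule ccontr)
  assume none: "\<not> ?thesis"
  have zero: "euler_fun (of_real (nome ^ j) * x) = 0" for j
  proof (induction j)
    case (Suc j)
    have "1 - of_real (nome ^ j) * x \<noteq> 0"
      using none by auto
    then show ?case
      using Suc euler_fun_scale [of "of_real (nome ^ j) * x"] by (simp add: mult_ac)
  qed (use assms in simp)
  have "(\<lambda>j. of_real (nome ^ j) * x) \<longlonglongrightarrow> of_real 0 * x"
    using nome_bounds by (intro tendsto_intros LIMSEQ_power_zero) auto
  then have "(\<lambda>j. euler_fun (of_real (nome ^ j) * x)) \<longlonglongrightarrow> euler_fun (of_real 0 * x)"
    by (rule continuous_on_tendsto_compose [OF holomorphic_on_imp_continuous_on
        [OF euler_fun_holomorphic [of UNIV]]]) auto
  then have "euler_fun 0 = 0"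
    by (simp only: zero of_real_0 mult_zero_left LIMSEQ_const_iff)
  then show False by simp
qed

section \<open>A theta function\<close>

text \<open>
  Up to a constant this is Jacobi's theta function in the logarithmic coordinate: its zeros are the
  odd integers and their translates by multiples of \<open>2 * pi * \<i>\<close>.
\<close>

definition theta :: "complex \<Rightarrow> complex"
  where "theta s = euler_fun (exp (s - 1)) * euler_fun (exp (- s - 1))"

lemma theta_holomorphic: "theta holomorphic_on S"
proof -
  have *: "(\<lambda>s. euler_fun (g s)) holomorphic_on S" if "g holomorphic_on S" for g
    using holomorphic_on_compose [OF that euler_fun_holomorphic] by (simp add: o_def)
  show ?thesis
    unfolding theta_def by (intro holomorphic_intros *)
qed

lemma theta_compose_continuous:
  assumes "continuous_on S g"
  shows "continuous_on S (\<lambda>x. theta (g x))"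
  by (rule continuous_on_compose2 [OF holomorphic_on_imp_continuous_on
      [OF theta_holomorphic [of UNIV]] assms]) auto

lemma theta_cnj: "theta (cnj s) = cnj (theta s)"
proof -
  have "exp (cnj s - 1) = cnj (exp (s - 1))" "exp (- cnj s - 1) = cnj (exp (- s - 1))"
    by (simp_all add: exp_cnj)
  then show ?thesis
    by (simp add: theta_def euler_fun_cnj)
qed

lemma theta_period: "theta (s + 2 * of_real pi * \<i>) = theta s"
proof -
  have "exp (s + 2 * of_real pi * \<i> - 1) = exp (s - 1) * exp (2 * of_real pi * \<i>)"
    "exp (- (s + 2 * of_real pi * \<i>) - 1) = exp (- s - 1) / exp (2 * of_real pi * \<i>)"
    unfolding exp_add [symmetric] exp_diff [symmetric] by (auto intro!: arg_cong [of _ _ exp])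
  then have "exp (s + 2 * of_real pi * \<i> - 1) = exp (s - 1)"
    "exp (- (s + 2 * of_real pi * \<i>) - 1) = exp (- s - 1)"
    by (simp_all only: exp_two_pi_i mult_1_right div_by_1)
  then show ?thesis
    by (simp only: theta_def)
qed

lemma theta_shift: "theta (s + 2) = - exp (s + 1) * theta s"
proof -
  have nome: "of_real nome = exp (- 2 :: complex)"
    unfolding nome_def by (metis exp_of_real of_real_minus of_real_numeral)
  have 1: "euler_fun (exp (s + 2 - 1)) = (1 - exp (s + 1)) * euler_fun (exp (s - 1))"
    using euler_fun_scale [of "exp (s + 1)"] by (simp add: nome algebra_simps flip: exp_add)
  have 2: "euler_fun (exp (- s - 1)) = (1 - exp (- s - 1)) * euler_fun (exp (- (s + 2) - 1))"
    using euler_fun_scale [of "exp (- s - 1)"] by (simp add: nome algebra_simps flip: exp_add)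
  have "1 - exp (s + 1) = - exp (s + 1) * (1 - exp (- s - 1))"
    by (simp add: algebra_simps flip: exp_add)
  with 1 have "theta (s + 2) = - exp (s + 1) * (1 - exp (- s - 1)) * euler_fun (exp (s - 1)) *
      euler_fun (exp (- (s + 2) - 1))"
    by (simp only: theta_def)
  then show ?thesis
    by (simp only: theta_def 2 mult_ac)
qed

lemma theta_nonzero_near_0:
  assumes "\<bar>Re s\<bar> < 1"
  shows "theta s \<noteq> 0"
proof -
  have "euler_fun x \<noteq> 0" if "norm x < 1" for x
  proof
    assume "euler_fun x = 0"
    then obtain j where "of_real (nome ^ j) * x = 1"
      using euler_fun_zero by blast
    then have "nome ^ j * norm x = 1"
      using nome_bounds by (metis abs_of_pos norm_mult norm_of_real norm_one zero_less_power)
    moreover have "nome ^ j * norm x \<le> 1 * norm x"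
      using nome_bounds by (intro mult_right_mono power_le_one) auto
    ultimately show False
      using that by simp
  qed
  then show ?thesis
    using assms by (simp add: theta_def)
qed

lemma theta_nonzero_off_real:
  assumes "0 < Im s" "Im s < 2 * pi"
  shows "theta s \<noteq> 0"
proof
  assume "theta s = 0"
  then consider "euler_fun (exp (s - 1)) = 0" | "euler_fun (exp (- s - 1)) = 0"
    by (auto simp: theta_def)
  then have "\<exists>r>0. exp s = of_real r"
  proof cases
    case 1
    then obtain j where "of_real (nome ^ j) * exp (s - 1) = 1"
      using euler_fun_zero by blast
    then have "exp s = of_real (exp 1 / nome ^ j)"
      using nome_bounds by (simp add: exp_diff field_simps flip: exp_of_real)
    then show ?thesis
      using nome_bounds by (intro exI [of _ "exp 1 / nome ^ j"]) simp
  next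
    case 2
    then obtain j where "of_real (nome ^ j) * exp (- s - 1) = 1"
      using euler_fun_zero by blast
    then have "exp s = of_real (nome ^ j / exp 1)"
      by (simp add: exp_diff exp_minus field_simps flip: exp_of_real)
    then show ?thesis
      using nome_bounds by (intro exI [of _ "nome ^ j / exp 1"]) simp
  qed
  then obtain r where r: "0 < r" "exp s = of_real r"
    by blast
  then have "exp (Re s) = r"
    using norm_exp_eq_Re [of s] by simp
  moreover have "exp (Re s) * cos (Im s) = r"
    using arg_cong [OF r(2), of Re] by (simp add: Re_exp)
  ultimately have "cos (2 * (Im s / 2)) = 1"
    using r(1) by simp
  then have "sin (Im s / 2) = 0"
    unfolding cos_double_sin by simp
  moreover have "0 < sin (Im s / 2)"
    using assms by (intro sin_gt_zero) auto
  ultimately show False by simp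
qed

section \<open>Inner functions on a strip\<close>

definition strip :: "complex set"
  where "strip = {s. \<bar>Im s\<bar> \<le> pi / 2}"

text \<open>A compact fundamental domain of the strip for the translation by 2.\<close>

definition cell :: "complex set"
  where "cell = cbox (Complex 0 (- pi / 2)) (Complex 2 (pi / 2))"

text \<open>
  Translation by a suitable even integer moves any point of the strip into the fundamental domain and
  leaves the modulus unchanged, so bounds obtained there by compactness hold on the whole strip.
\<close>

lemma periodic_norm_bound:
  fixes g :: "complex \<Rightarrow> complex"
  assumes period: "\<And>s. norm (g (s + 2)) = norm (g s)"
    and cell: "\<And>s. s \<in> cell \<Longrightarrow> norm (g s) \<le> B" and s: "s \<in> strip"
  shows "norm (g s) \<le> B"
proof -
  have nat: "norm (g (s + 2 * of_nat m)) = norm (g s)" for s m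
  proof (induction m)
    case (Suc m)
    then show ?case
      using period [of "s + 2 * of_nat m"] by (simp add: algebra_simps)
  qed simp
  have int: "norm (g (s + 2 * of_int m)) = norm (g s)" for s m
  proof (cases m)
    case (nonneg k)
    then show ?thesis using nat [of s k] by simp
  next
    case (neg k)
    then show ?thesis using nat [of "s + 2 * of_int m" "Suc k"] by simp
  qed
  define m where "m = \<lfloor>Re s / 2\<rfloor>"
  have "of_int m \<le> Re s / 2" "Re s / 2 < of_int m + 1"
    unfolding m_def by linarith+
  then have "s + 2 * of_int (- m) \<in> cell"
    using s by (auto simp: cell_def strip_def in_cbox_complex_iff)
  from cell [OF this] show ?thesis
    unfolding int .
qed

text \<open>
  A Blaschke product of the strip, with zeros \<open>2 * j + 1 + \<i> * \<phi>\<close>, where \<open>j\<close> ranges over the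
  integers: the denominator is the reflection of the numerator in the boundary lines.
\<close>

definition strip_inner :: "real \<Rightarrow> complex \<Rightarrow> complex"
  where "strip_inner \<phi> s = theta (s - \<i> * of_real \<phi>) / theta (s + \<i> * of_real \<phi> + \<i> * of_real pi)"

lemma strip_inner_denom:
  assumes "\<bar>\<phi>\<bar> \<le> 1" "s \<in> strip"
  shows "theta (s + \<i> * of_real \<phi> + \<i> * of_real pi) \<noteq> 0"
  using assms pi_gt3 by (intro theta_nonzero_off_real) (auto simp: strip_def)

text \<open>
  Moving the row of zeros up by \<open>\<phi>\<close> changes the multiplier of the translation by 2 from \<open>- 1\<close> to
  \<open>- exp (- (2 * \<i> * \<phi>))\<close>.
\<close>

lemma strip_inner_shift: "strip_inner \<phi> (s + 2) = - exp (- (2 * \<i> * of_real \<phi>)) * strip_inner \<phi> s"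
proof -
  let ?a = "s - \<i> * of_real \<phi>" and ?b = "s + \<i> * of_real \<phi> + \<i> * of_real pi"
  have a: "theta (s + 2 - \<i> * of_real \<phi>) = - exp (?a + 1) * theta ?a"
    using theta_shift [of ?a] by (simp add: algebra_simps)
  have b: "theta (s + 2 + \<i> * of_real \<phi> + \<i> * of_real pi) = - exp (?b + 1) * theta ?b"
    using theta_shift [of ?b] by (simp add: algebra_simps)
  have "exp (?b + 1) = exp (s + \<i> * of_real \<phi> + 1) * exp (\<i> * of_real pi)"
    unfolding exp_add [symmetric] by (simp only: ac_simps)
  moreover have "exp (\<i> * of_real pi) = - 1"
    using exp_pi_i by (simp add: mult.commute)
  ultimately have b1: "exp (?b + 1) = - exp (s + \<i> * of_real \<phi> + 1)"
    by simp
  have "exp (?a + 1) / exp (s + \<i> * of_real \<phi> + 1) = exp (- (2 * \<i> * of_real \<phi>))"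
    unfolding exp_diff [symmetric] by (simp add: algebra_simps)
  then have "exp (?a + 1) / - exp (?b + 1) = exp (- (2 * \<i> * of_real \<phi>))"
    by (simp add: b1)
  then show ?thesis
    unfolding strip_inner_def a b times_divide_times_eq [symmetric]
    by (simp add: field_simps)
qed

lemma norm_strip_inner_shift: "norm (strip_inner \<phi> (s + 2)) = norm (strip_inner \<phi> s)"
  unfolding strip_inner_shift by (simp add: norm_mult)

text \<open>
  On the boundary lines, numerator and denominator are evaluated at conjugate points, up to the
  period \<open>2 * pi * \<i>\<close> on the upper line.
\<close>

lemma norm_strip_inner_boundary:
  assumes "\<bar>\<phi>\<bar> \<le> 1" "\<bar>Im s\<bar> = pi / 2"
  shows "norm (strip_inner \<phi> s) = 1"
proof -
  let ?b = "s + \<i> * of_real \<phi> + \<i> * of_real pi"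
  have "theta (cnj (s - \<i> * of_real \<phi>)) = theta ?b"
  proof (cases "Im s = pi / 2")
    case True
    then have "?b = cnj (s - \<i> * of_real \<phi>) + 2 * of_real pi * \<i>"
      by (simp add: complex_eq_iff)
    then show ?thesis
      by (simp only: theta_period)
  next
    case False
    then have "?b = cnj (s - \<i> * of_real \<phi>)"
      using assms(2) by (auto simp: complex_eq_iff abs_if split: if_splits)
    then show ?thesis by (simp only:)
  qed
  then have "norm (theta (s - \<i> * of_real \<phi>)) = norm (theta ?b)"
    by (metis theta_cnj complex_mod_cnj)
  moreover have "theta ?b \<noteq> 0"
    by (rule strip_inner_denom) (use assms in \<open>auto simp: strip_def\<close>)
  ultimately show ?thesis
    by (simp add: strip_inner_def norm_divide)
qed

lemma strip_inner_0_nonzero: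
  assumes "\<bar>\<phi>\<bar> \<le> 1"
  shows "strip_inner \<phi> 0 \<noteq> 0"
  using theta_nonzero_near_0 [of "- (\<i> * of_real \<phi>)"] strip_inner_denom [OF assms, of 0]
  by (simp add: strip_inner_def strip_def)

lemma norm_strip_inner_even: "norm (strip_inner \<phi> (2 * of_nat m)) = norm (strip_inner \<phi> 0)"
proof (induction m)
  case (Suc m)
  then show ?case
    using norm_strip_inner_shift [of \<phi> "2 * of_nat m"] by (simp add: algebra_simps)
qed simp

lemma strip_inner_holomorphic:
  assumes "\<bar>\<phi>\<bar> \<le> 1"
  shows "strip_inner \<phi> holomorphic_on strip"
proof -
  have *: "(\<lambda>s. theta (g s)) holomorphic_on strip" if "g holomorphic_on strip" for g
    using holomorphic_on_compose [OF that theta_holomorphic] by (simp add: o_def)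
  show ?thesis
    unfolding strip_inner_def by (intro holomorphic_intros * strip_inner_denom assms)
qed

lemma cell_subset_strip: "cell \<subseteq> strip"
  by (auto simp: cell_def strip_def in_cbox_complex_iff)

lemma strip_inner_bounded:
  assumes "\<bar>\<phi>\<bar> \<le> 1"
  shows "\<exists>B. \<forall>s\<in>strip. norm (strip_inner \<phi> s) \<le> B"
proof -
  have "continuous_on cell (strip_inner \<phi>)"
    by (rule continuous_on_subset [OF holomorphic_on_imp_continuous_on
        [OF strip_inner_holomorphic [OF assms]] cell_subset_strip])
  moreover have "compact cell"
    by (simp add: cell_def)
  ultimately have "bounded (strip_inner \<phi> ` cell)"
    by (intro compact_imp_bounded compact_continuous_image)
  then obtain B where "\<And>s. s \<in> cell \<Longrightarrow> norm (strip_inner \<phi> s) \<le> B"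
    unfolding bounded_iff by blast
  then show ?thesis
    using periodic_norm_bound [of "strip_inner \<phi>", OF norm_strip_inner_shift] by blast
qed

text \<open>
  The exponential factor is chosen so that the multiplier of the translation by 2 is \<open>- 1\<close> for every
  \<open>\<phi>\<close>. That factor is bounded with bounded inverse on the strip.
\<close>

definition strip_fun :: "real \<Rightarrow> complex \<Rightarrow> complex"
  where "strip_fun \<phi> s = strip_inner \<phi> s * exp (\<i> * of_real \<phi> * s)"

lemma strip_fun_shift: "strip_fun \<phi> (s + 2) = - strip_fun \<phi> s"
proof -
  have "exp (- (2 * \<i> * of_real \<phi>)) * exp (\<i> * of_real \<phi> * (s + 2)) = exp (\<i> * of_real \<phi> * s)"
    by (simp add: algebra_simps flip: exp_add)
  then show ?thesis
    unfolding strip_fun_def strip_inner_shift by (simp add: mult_ac)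
qed

text \<open>
  Since the multiplier does not depend on \<open>\<phi>\<close>, the difference of two of these functions has periodic
  modulus, and uniform continuity on the fundamental domain controls it on the whole strip. The
  exponential factors by themselves do not converge uniformly.
\<close>

lemma strip_fun_uniform_limit:
  assumes "0 < \<epsilon>"
  shows "\<exists>\<delta>>0. \<forall>\<phi>. \<bar>\<phi>\<bar> < \<delta> \<longrightarrow> (\<forall>s\<in>strip. norm (strip_fun \<phi> s - strip_fun 0 s) \<le> \<epsilon>)"
proof -
  let ?K = "{- 1..1 :: real} \<times> cell"
  let ?F = "\<lambda>(\<phi>, s). strip_fun \<phi> s"
  \<comment> \<open>joint continuity in the parameter and the point, on a compact set\<close>
  have "continuous_on ?K ?F"
    unfolding strip_fun_def strip_inner_def case_prod_beta
    by (intro continuous_intros theta_compose_continuous)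
      (use strip_inner_denom cell_subset_strip in \<open>fastforce simp: abs_le_iff\<close>)
  moreover have "compact ?K"
    unfolding cell_def by (intro compact_Times compact_Icc compact_cbox)
  ultimately have "uniformly_continuous_on ?K ?F"
    by (rule compact_uniformly_continuous)
  then obtain d where d: "0 < d" "\<And>x y. x \<in> ?K \<Longrightarrow> y \<in> ?K \<Longrightarrow> dist y x < d \<Longrightarrow> dist (?F y) (?F x) < \<epsilon>"
    using assms unfolding uniformly_continuous_on_def by metis
  show ?thesis
  proof (intro exI [of _ "min d 1"] conjI allI impI ballI)
    fix \<phi> :: real and s assume \<phi>: "\<bar>\<phi>\<bar> < min d 1" and s: "s \<in> strip"
    show "norm (strip_fun \<phi> s - strip_fun 0 s) \<le> \<epsilon>"
    proof (rule periodic_norm_bound [OF _ _ s])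
      show "norm (strip_fun \<phi> (s + 2) - strip_fun 0 (s + 2)) = norm (strip_fun \<phi> s - strip_fun 0 s)" for s
        unfolding strip_fun_shift by (simp add: norm_minus_commute)
      show "norm (strip_fun \<phi> s - strip_fun 0 s) \<le> \<epsilon>" if "s \<in> cell" for s
      proof -
        have "\<phi> \<in> {- 1..1}"
          using \<phi> by (auto simp: abs_less_iff)
        then show ?thesis
          using d(2) [of "(0, s)" "(\<phi>, s)"] \<phi> that by (simp add: dist_norm dist_Pair_Pair)
      qed
    qed
  qed (use d in auto)
qed

section \<open>From the strip to the disc\<close>

text \<open>The conformal map of the disc onto the interior of the strip.\<close>

definition to_strip :: "complex \<Rightarrow> complex"
  where "to_strip z = Ln ((1 + z) / (1 - z))"

lemma Re_cayley: "Re ((1 + z) / (1 - z)) = (1 - (norm z)\<^sup>2) / (norm (1 - z))\<^sup>2"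
  and Im_cayley: "Im ((1 + z) / (1 - z)) = 2 * Im z / (norm (1 - z))\<^sup>2"
  unfolding Re_divide Im_divide cmod_power2 by (simp_all add: power2_eq_square algebra_simps)

lemma Re_cayley_pos:
  assumes "z \<in> ball 0 1"
  shows "0 < Re ((1 + z) / (1 - z))"
proof -
  have "z \<noteq> 1" "(norm z)\<^sup>2 < 1"
    using assms by (auto simp: abs_square_less_1)
  then show ?thesis
    unfolding Re_cayley by simp
qed

lemma to_strip_in_strip: "z \<in> ball 0 1 \<Longrightarrow> to_strip z \<in> strip"
  using Re_Ln_pos_lt_imp [OF Re_cayley_pos, of z] by (simp add: to_strip_def strip_def)

lemma to_strip_holomorphic: "to_strip holomorphic_on ball 0 1"
proof -
  have "(1 + z) / (1 - z) \<notin> \<real>\<^sub>\<le>\<^sub>0" if "z \<in> ball 0 1" for z :: complex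
    using Re_cayley_pos [OF that] by (simp add: complex_nonpos_Reals_iff del: Re_divide)
  then show ?thesis
    unfolding to_strip_def by (intro holomorphic_intros) auto
qed

lemma to_strip_0 [simp]: "to_strip 0 = 0"
  by (simp add: to_strip_def)

lemma to_strip_boundary:
  assumes "norm z = 1" "Im z \<noteq> 0"
  shows "isCont to_strip z" "\<bar>Im (to_strip z)\<bar> = pi / 2"
proof -
  have z: "z \<noteq> 1"
    using assms(2) by auto
  have im: "Im ((1 + z) / (1 - z)) \<noteq> 0" and re: "Re ((1 + z) / (1 - z)) = 0"
    unfolding Re_cayley Im_cayley using assms z by auto
  then have "(1 + z) / (1 - z) \<notin> \<real>\<^sub>\<le>\<^sub>0"
    by (auto simp: complex_nonpos_Reals_iff)
  then show "isCont to_strip z"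
    unfolding to_strip_def using z by (intro continuous_intros) auto
  have nz: "(1 + z) / (1 - z) \<noteq> 0"
    using im by force
  have "\<bar>Im (to_strip z)\<bar> \<le> pi / 2" "\<not> \<bar>Im (to_strip z)\<bar> < pi / 2"
    unfolding to_strip_def using Re_Ln_pos_le [OF nz] Re_Ln_pos_lt [OF nz] re by auto
  then show "\<bar>Im (to_strip z)\<bar> = pi / 2"
    by linarith
qed

text \<open>
  The value is specified only when \<open>g\<close> is holomorphic and bounded on the disc.
\<close>

definition disc_fun :: "(complex \<Rightarrow> complex) \<Rightarrow> hinf"
  where "disc_fun g = Abs_hinf (\<lambda>z. if z \<in> ball 0 1 then g z else 0)"

lemma happ_disc_fun:
  assumes "g holomorphic_on ball 0 1" "\<And>z. z \<in> ball 0 1 \<Longrightarrow> norm (g z) \<le> B" "z \<in> ball 0 1"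
  shows "happ (disc_fun g) z = g z"
proof -
  let ?g = "\<lambda>z. if z \<in> ball 0 1 then g z else 0"
  have "?g holomorphic_on ball 0 1"
    by (rule holomorphic_transform [OF assms(1)]) auto
  moreover have "bounded (?g ` ball 0 1)"
    using assms(2) by (intro boundedI [of _ B]) auto
  ultimately have "happ (disc_fun g) = ?g"
    unfolding disc_fun_def by (intro Abs_hinf_inverse) auto
  then show ?thesis
    using assms(3) by simp
qed

lemma happ_disc_fun_strip:
  assumes "g holomorphic_on strip" "\<exists>B. \<forall>s\<in>strip. norm (g s) \<le> B" "z \<in> ball 0 1"
  shows "happ (disc_fun (\<lambda>z. g (to_strip z))) z = g (to_strip z)"
proof -
  obtain B where B: "\<And>s. s \<in> strip \<Longrightarrow> norm (g s) \<le> B"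
    using assms(2) by blast
  have "(g \<circ> to_strip) holomorphic_on ball 0 1"
    by (rule holomorphic_on_compose_gen [OF to_strip_holomorphic assms(1)])
      (auto intro: to_strip_in_strip)
  then show ?thesis
    using B to_strip_in_strip assms(3) by (intro happ_disc_fun [where B = B]) (auto simp: o_def)
qed

definition const_hinf :: "complex \<Rightarrow> hinf"
  where "const_hinf c = disc_fun (\<lambda>_. c)"

definition id_hinf :: hinf
  where "id_hinf = disc_fun (\<lambda>z. z)"

definition inner_part :: "real \<Rightarrow> hinf"
  where "inner_part \<phi> = disc_fun (\<lambda>z. strip_inner \<phi> (to_strip z))"

definition unit_part :: "real \<Rightarrow> hinf"
  where "unit_part \<phi> = disc_fun (\<lambda>z. exp (\<i> * of_real \<phi> * to_strip z))"

lemma happ_const_hinf: "z \<in> ball 0 1 \<Longrightarrow> happ (const_hinf c) z = c"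
  unfolding const_hinf_def by (rule happ_disc_fun [where B = "norm c"]) auto

lemma happ_id_hinf: "z \<in> ball 0 1 \<Longrightarrow> happ id_hinf z = z"
  unfolding id_hinf_def by (rule happ_disc_fun [where B = 1]) auto

lemma happ_inner_part:
  assumes "\<bar>\<phi>\<bar> \<le> 1" "z \<in> ball 0 1"
  shows "happ (inner_part \<phi>) z = strip_inner \<phi> (to_strip z)"
  unfolding inner_part_def
  by (rule happ_disc_fun_strip [OF strip_inner_holomorphic strip_inner_bounded]) (use assms in auto)

lemma norm_exp_strip:
  assumes "\<bar>\<phi>\<bar> \<le> 1" "s \<in> strip"
  shows "norm (exp (\<i> * of_real \<phi> * s)) \<le> exp 2"
proof -
  have "\<bar>\<phi> * Im s\<bar> \<le> 1 * (pi / 2)"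
    using assms unfolding abs_mult by (intro mult_mono) (auto simp: strip_def)
  then show ?thesis
    using pi_less_4 by (simp add: abs_le_iff)
qed

lemma happ_unit_part:
  assumes "\<bar>\<phi>\<bar> \<le> 1" "z \<in> ball 0 1"
  shows "happ (unit_part \<phi>) z = exp (\<i> * of_real \<phi> * to_strip z)"
  unfolding unit_part_def
proof (rule happ_disc_fun_strip)
  show "\<exists>B. \<forall>s\<in>strip. norm (exp (\<i> * of_real \<phi> * s)) \<le> B"
    using norm_exp_strip [OF assms(1)] by blast
qed (intro holomorphic_intros assms)+

lemma const_hinf_unit: "c \<noteq> 0 \<Longrightarrow> const_hinf c * const_hinf (1 / c) = 1"
  by (intro hinf_eqI) (simp add: happ_const_hinf happ_one)

lemma unit_part_inverse:
  assumes "\<bar>\<phi>\<bar> \<le> 1"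
  shows "unit_part \<phi> * unit_part (- \<phi>) = 1"
  using assms by (intro hinf_eqI) (simp add: happ_unit_part happ_one flip: exp_add)

section \<open>The inner functions on the disc\<close>

lemma AE_circle_off_real: "AE t in lebesgue_on {0..2 * pi}. sin t \<noteq> 0"
proof (rule AE_I')
  show "{0, pi, 2 * pi} \<in> null_sets (lebesgue_on {0..2 * pi})"
    using negligible_finite [of "{0, pi, 2 * pi}"]
    by (subst null_sets_restrict_space) (auto simp: negligible_iff_null_sets)
  have "t \<in> {0, pi, 2 * pi}" if "0 \<le> t" "t \<le> 2 * pi" "sin t = 0" for t
  proof (rule ccontr)
    assume "t \<notin> {0, pi, 2 * pi}"
    then consider "0 < t" "t < pi" | "pi < t" "t < 2 * pi"
      using \<open>0 \<le> t\<close> \<open>t \<le> 2 * pi\<close> by fastforce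
    then show False
      using sin_gt_zero [of t] sin_lt_zero [of t] \<open>sin t = 0\<close> by cases auto
  qed
  then show "{t \<in> space (lebesgue_on {0..2 * pi}). \<not> sin t \<noteq> 0} \<subseteq> {0, pi, 2 * pi}"
    by auto
qed

lemma eventually_disc: "\<forall>\<^sub>F r in at_left 1. of_real r * cis t \<in> ball 0 1"
  using eventually_at_left_real [of 0 "1::real"]
  by (auto elim!: eventually_mono simp: norm_mult)

lemma tendsto_radial: "((\<lambda>r. of_real r * cis t) \<longlongrightarrow> cis t) (at_left 1)"
proof -
  have "((\<lambda>r. of_real r * cis t) \<longlongrightarrow> of_real 1 * cis t) (at_left 1)"
    by (intro tendsto_intros)
  then show ?thesis by simp
qed

text \<open>
  The conformal map is continuous at every boundary point other than 1 and -1, and takes it to a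
  boundary line of the strip.
\<close>

lemma inner_fun_inner_part:
  assumes \<phi>: "\<bar>\<phi>\<bar> \<le> 1"
  shows "inner_fun (inner_part \<phi>)"
  unfolding inner_fun_def using AE_circle_off_real
proof eventually_elim
  fix t :: real assume "sin t \<noteq> 0"
  then have b: "isCont to_strip (cis t)" "\<bar>Im (to_strip (cis t))\<bar> = pi / 2"
    using to_strip_boundary [of "cis t"] by auto
  have "((\<lambda>r. to_strip (of_real r * cis t)) \<longlongrightarrow> to_strip (cis t)) (at_left 1)"
    by (rule isCont_tendsto_compose [OF b(1) tendsto_radial])
  then have "((\<lambda>r. strip_inner \<phi> (to_strip (of_real r * cis t))) \<longlongrightarrow>
      strip_inner \<phi> (to_strip (cis t))) (at_left 1)"
  proof (rule continuous_on_tendsto_compose [OF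
        holomorphic_on_imp_continuous_on [OF strip_inner_holomorphic [OF \<phi>]]])
    show "to_strip (cis t) \<in> strip"
      using b(2) by (simp add: strip_def)
    show "\<forall>\<^sub>F r in at_left 1. to_strip (of_real r * cis t) \<in> strip"
      using eventually_disc by (rule eventually_mono) (rule to_strip_in_strip)
  qed
  moreover have "\<forall>\<^sub>F r in at_left 1. strip_inner \<phi> (to_strip (of_real r * cis t)) =
      happ (inner_part \<phi>) (of_real r * cis t)"
    using eventually_disc [of t] by (rule eventually_mono) (simp only: happ_inner_part [OF \<phi>])
  ultimately have "((\<lambda>r. happ (inner_part \<phi>) (of_real r * cis t)) \<longlongrightarrow>
      strip_inner \<phi> (to_strip (cis t))) (at_left 1)"
    by (rule Lim_transform_eventually)
  then show "\<exists>l. norm l = 1 \<and> ((\<lambda>r. happ (inner_part \<phi>) (of_real r * cis t)) \<longlongrightarrow> l) (at_left 1)"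
    using norm_strip_inner_boundary [OF \<phi> b(2)] by blast
qed

lemma inner_fun_mult:
  assumes "inner_fun u" "inner_fun v"
  shows "inner_fun (u * v)"
  using assms unfolding inner_fun_def
proof eventually_elim
  fix t
  assume "\<exists>l. norm l = 1 \<and> ((\<lambda>r. happ u (of_real r * cis t)) \<longlongrightarrow> l) (at_left 1)"
    and "\<exists>l. norm l = 1 \<and> ((\<lambda>r. happ v (of_real r * cis t)) \<longlongrightarrow> l) (at_left 1)"
  then obtain l m where "norm l = 1" "((\<lambda>r. happ u (of_real r * cis t)) \<longlongrightarrow> l) (at_left 1)"
    and "norm m = 1" "((\<lambda>r. happ v (of_real r * cis t)) \<longlongrightarrow> m) (at_left 1)"
    by blast
  then show "\<exists>l. norm l = 1 \<and> ((\<lambda>r. happ (u * v) (of_real r * cis t)) \<longlongrightarrow> l) (at_left 1)"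
    by (intro exI [of _ "l * m"]) (auto simp: norm_mult intro!: tendsto_mult)
qed

lemma inner_fun_const: "norm c = 1 \<Longrightarrow> inner_fun (const_hinf c)"
  unfolding inner_fun_def
proof (rule AE_I2, intro exI conjI)
  fix t
  have "\<forall>\<^sub>F r in at_left 1. happ (const_hinf c) (of_real r * cis t) = c"
    using eventually_disc by (rule eventually_mono) (rule happ_const_hinf)
  then show "((\<lambda>r. happ (const_hinf c) (of_real r * cis t)) \<longlongrightarrow> c) (at_left 1)"
    by (rule tendsto_eventually)
qed

lemma inner_fun_id: "inner_fun id_hinf"
  unfolding inner_fun_def
proof (rule AE_I2, intro exI conjI)
  fix t
  have "\<forall>\<^sub>F r in at_left 1. of_real r * cis t = happ id_hinf (of_real r * cis t)"
    using eventually_disc [of t] by (rule eventually_mono) (simp only: happ_id_hinf)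
  with tendsto_radial show "((\<lambda>r. happ id_hinf (of_real r * cis t)) \<longlongrightarrow> cis t) (at_left 1)"
    by (rule Lim_transform_eventually)
qed simp

lemma inner_fun_power: "inner_fun u \<Longrightarrow> inner_fun (u ^ n)"
  by (induction n) (auto intro: inner_fun_mult inner_fun_one)

lemma happ_power_id: "z \<in> ball 0 1 \<Longrightarrow> happ (id_hinf ^ n) z = z ^ n"
  by (induction n) (simp_all add: happ_one happ_id_hinf)

lemma higher_deriv_monomial_times:
  assumes "k \<le> n"
  shows "(deriv ^^ k) (happ (id_hinf ^ n * w)) 0 = (if k = n then fact n * happ w 0 else 0)"
proof -
  have mono: "(deriv ^^ i) (happ (id_hinf ^ n)) 0 = (if i = n then fact n else 0)" if "i \<le> n" for i
  proof -
    have "\<forall>\<^sub>F z in nhds 0. z \<in> ball (0 :: complex) 1"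
      by (rule eventually_nhds_in_open) auto
    then have "\<forall>\<^sub>F z in nhds 0. happ (id_hinf ^ n) z = (z - 0) ^ n"
      by (rule eventually_mono) (simp add: happ_power_id)
    then have "(deriv ^^ i) (happ (id_hinf ^ n)) 0 = (deriv ^^ i) (\<lambda>z. (z - 0) ^ n) 0"
      by (rule higher_deriv_cong_ev) simp
    then show ?thesis
      using that by (simp only: higher_deriv_power) (auto simp: pochhammer_fact)
  qed
  have "(deriv ^^ k) (happ (id_hinf ^ n * w)) 0 =
      (\<Sum>i = 0..k. of_nat (k choose i) * (deriv ^^ i) (happ (id_hinf ^ n)) 0 * (deriv ^^ (k - i)) (happ w) 0)"
    unfolding times_hinf.rep_eq
    by (rule higher_deriv_mult [OF happ_holomorphic happ_holomorphic]) auto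
  also have "\<dots> = (\<Sum>i = 0..k. if i = n then fact n * happ w 0 else 0)"
    using assms by (intro sum.cong) (auto simp: mono)
  also have "\<dots> = (if k = n then fact n * happ w 0 else 0)"
    using assms by simp
  finally show ?thesis .
qed

lemma Mul0_monomial_times:
  assumes "happ w 0 \<noteq> 0"
  shows "Mul0 (id_hinf ^ n * w) = n"
  unfolding Mul0_def
proof (rule Least_equality)
  show "(deriv ^^ n) (happ (id_hinf ^ n * w)) 0 \<noteq> 0"
    using higher_deriv_monomial_times [of n n w] assms by simp
  show "n \<le> k" if "(deriv ^^ k) (happ (id_hinf ^ n * w)) 0 \<noteq> 0" for k
    using higher_deriv_monomial_times [of k n w] that by (metis nat_le_linear order_refl)
qed

section \<open>The discontinuity\<close>

text \<open>The rotation that normalizes the inner factor.\<close>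

definition phase :: "real \<Rightarrow> complex"
  where "phase \<phi> = sgn (strip_inner \<phi> 0)"

definition family_inner :: "nat \<Rightarrow> real \<Rightarrow> hinf"
  where "family_inner n \<phi> = id_hinf ^ n * (const_hinf (cnj (phase \<phi>)) * inner_part \<phi>)"

definition family_outer :: "real \<Rightarrow> hinf"
  where "family_outer \<phi> = const_hinf (phase \<phi>) * unit_part \<phi>"

definition family :: "nat \<Rightarrow> real \<Rightarrow> hinf"
  where "family n \<phi> = family_inner n \<phi> * family_outer \<phi>"

lemma norm_phase: "\<bar>\<phi>\<bar> \<le> 1 \<Longrightarrow> norm (phase \<phi>) = 1"
  by (simp add: phase_def norm_sgn strip_inner_0_nonzero)

lemma cnj_sgn_times: "cnj (sgn z) * z = of_real (norm z)"
proof (cases "z = 0")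
  case False
  have "cnj (sgn z) * z = (z * cnj z) / of_real (norm z)"
    by (simp add: sgn_div_norm scaleR_conv_of_real field_simps)
  also have "\<dots> = of_real (norm z)"
    using False by (simp add: complex_norm_square [symmetric] power2_eq_square)
  finally show ?thesis .
qed simp

lemma normalized_family_inner:
  assumes \<phi>: "\<bar>\<phi>\<bar> \<le> 1"
  shows "normalized_inner (family_inner n \<phi>)"
proof -
  let ?w = "const_hinf (cnj (phase \<phi>)) * inner_part \<phi>"
  have w: "happ ?w 0 = of_real (norm (strip_inner \<phi> 0))"
    using cnj_sgn_times [of "strip_inner \<phi> 0"]
    by (simp add: happ_const_hinf happ_inner_part [OF \<phi>] phase_def)
  have pos: "norm (strip_inner \<phi> 0) > 0"
    using strip_inner_0_nonzero [OF \<phi>] by simp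
  have M: "Mul0 (family_inner n \<phi>) = n"
    unfolding family_inner_def by (rule Mul0_monomial_times) (use w pos in simp)
  have d: "(deriv ^^ n) (happ (family_inner n \<phi>)) 0 = of_real (fact n * norm (strip_inner \<phi> 0))"
    unfolding family_inner_def by (simp add: higher_deriv_monomial_times w del: happ_times)
  have "inner_fun (family_inner n \<phi>)"
    unfolding family_inner_def
    by (intro inner_fun_mult inner_fun_power inner_fun_id inner_fun_const inner_fun_inner_part \<phi>)
      (simp add: norm_phase \<phi>)
  then show ?thesis
    unfolding normalized_inner_def M d using pos by (simp only: Reals_of_real Re_complex_of_real) simp
qed

lemma family_outer_unit:
  assumes \<phi>: "\<bar>\<phi>\<bar> \<le> 1"
  shows "family_outer \<phi> dvd 1"
proof
  have "phase \<phi> \<noteq> 0"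
    using norm_phase [OF \<phi>] by auto
  then show "1 = family_outer \<phi> * (const_hinf (1 / phase \<phi>) * unit_part (- \<phi>))"
    using const_hinf_unit [of "phase \<phi>"] unit_part_inverse [OF \<phi>]
    by (simp add: family_outer_def mult_ac)
qed

lemma family_eq:
  assumes \<phi>: "\<bar>\<phi>\<bar> \<le> 1"
  shows "family n \<phi> = id_hinf ^ n * (inner_part \<phi> * unit_part \<phi>)"
proof (rule hinf_eqI)
  fix z :: complex assume z: "z \<in> ball 0 1"
  have "cnj (phase \<phi>) * phase \<phi> = 1"
    using norm_phase [OF \<phi>] complex_norm_square [of "phase \<phi>"] by (simp add: mult.commute)
  then show "happ (family n \<phi>) z = happ (id_hinf ^ n * (inner_part \<phi> * unit_part \<phi>)) z"
    using happ_const_hinf [OF z] by (simp add: family_def family_inner_def family_outer_def mult_ac)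
qed

lemma family_factorization:
  assumes "\<bar>\<phi>\<bar> \<le> 1"
  shows "Q_inn (family n \<phi>) = family_inner n \<phi>" "Q_out (family n \<phi>) = family_outer \<phi>"
  using inner_outer_unit [OF normalized_family_inner family_outer_unit, OF assms assms]
  by (simp_all add: Q_inn_def Q_out_def family_def)

lemma family_in_I_star:
  assumes \<phi>: "\<bar>\<phi>\<bar> \<le> 1"
  shows "family n \<phi> \<in> I_star_n n"
proof -
  have "Mul0 (family n \<phi>) = n"
    unfolding family_eq [OF \<phi>]
    by (rule Mul0_monomial_times) (simp add: happ_inner_part happ_unit_part \<phi> strip_inner_0_nonzero)
  moreover have "family n \<phi> \<in> I_star"
    unfolding I_star_def family_def
    using normalized_family_inner [OF \<phi>] family_outer_unit [OF \<phi>]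
    by (auto simp: normalized_inner_def)
  ultimately show ?thesis
    by (simp add: I_star_n_def)
qed

lemma family_tendsto: "(family n \<longlongrightarrow> family n 0) (at 0)"
proof (rule tendstoI)
  fix \<epsilon> :: real assume "0 < \<epsilon>"
  then obtain \<delta> where \<delta>: "0 < \<delta>" and
    le: "\<And>\<phi> s. \<bar>\<phi>\<bar> < \<delta> \<Longrightarrow> s \<in> strip \<Longrightarrow> norm (strip_fun \<phi> s - strip_fun 0 s) \<le> \<epsilon> / 2"
    using strip_fun_uniform_limit [of "\<epsilon> / 2"] by auto
  have "dist (family n \<phi>) (family n 0) < \<epsilon>" if \<phi>: "\<bar>\<phi>\<bar> < min \<delta> 1" for \<phi>
  proof -
    have "norm (family n \<phi> - family n 0) \<le> \<epsilon> / 2"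
    proof (rule norm_hinf_leI)
      fix z :: complex assume z: "z \<in> ball 0 1"
      have "happ (family n \<phi> - family n 0) z =
          z ^ n * (strip_fun \<phi> (to_strip z) - strip_fun 0 (to_strip z))"
        using \<phi> z by (simp add: family_eq minus_hinf.rep_eq happ_power_id happ_inner_part
            happ_unit_part strip_fun_def algebra_simps)
      moreover have "norm (z ^ n) \<le> 1"
        using z by (simp add: norm_power power_le_one)
      moreover have "norm (strip_fun \<phi> (to_strip z) - strip_fun 0 (to_strip z)) \<le> \<epsilon> / 2"
        using le \<phi> to_strip_in_strip [OF z] by simp
      ultimately show "norm (happ (family n \<phi> - family n 0) z) \<le> \<epsilon> / 2"
        using mult_mono [of "norm (z ^ n)" 1 "norm (strip_fun \<phi> (to_strip z) - strip_fun 0 (to_strip z))" "\<epsilon> / 2"]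
        by (simp add: norm_mult)
    qed
    then show ?thesis
      using \<open>0 < \<epsilon>\<close> by (simp add: dist_norm)
  qed
  then show "\<forall>\<^sub>F \<phi> in at 0. dist (family n \<phi>) (family n 0) < \<epsilon>"
    unfolding eventually_at using \<delta> by (intro exI [of _ "min \<delta> 1"]) (auto simp: dist_norm)
qed

lemma to_strip_surj_real:
  fixes s :: real
  assumes "2 \<le> s"
  shows "\<exists>z\<in>ball 0 1. to_strip z = of_real s \<and> 1 / 2 \<le> norm z"
proof -
  define x where "x = (exp s - 1) / (exp s + 1)"
  have "3 \<le> exp s"
    using exp_ge_add_one_self [of s] assms by linarith
  then have x: "1 / 2 \<le> x" "x < 1"
    by (auto simp: x_def field_simps)
  have "(1 + x) / (1 - x) = exp s"
  proof -
    have "1 + x = 2 * exp s / (exp s + 1)" "1 - x = 2 / (exp s + 1)"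
      using exp_gt_zero [of s] by (simp_all add: x_def field_simps del: exp_gt_zero)
    then show ?thesis
      using exp_gt_zero [of s] by (simp add: add_pos_pos less_imp_neq [symmetric] del: exp_gt_zero)
  qed
  moreover have "to_strip (of_real x) = Ln (of_real ((1 + x) / (1 - x)))"
    by (simp add: to_strip_def)
  ultimately have "to_strip (of_real x) = of_real s"
    by (simp add: Ln_of_real del: of_real_exp)
  then show ?thesis
    using x by (intro bexI [of _ "of_real x"]) auto
qed

text \<open>
  Along the real line of the strip the outer factor is \<open>phase \<phi> * exp (\<i> * \<phi> * s)\<close>. For
  \<open>\<phi> = pi / (2 * m)\<close> the exponential is \<open>- 1\<close> at \<open>s = 2 * m\<close> and \<open>1\<close> at \<open>s = 4 * m\<close>, so at one of the
  two points the outer factors for \<open>\<phi>\<close> and 0 differ by at least 1, whatever the phases are. At even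
  integers the modulus of the inner factor does not depend on the point, apart from the monomial,
  which is at least \<open>(1 / 2) ^ n\<close> there.
\<close>

lemma outer_parts_apart:
  fixes m :: nat
  assumes "1 \<le> m" and \<phi>: "\<phi> = pi / (2 * real m)" "\<phi> \<le> 1"
  shows "(1 / 2) ^ n * norm (strip_inner 0 0) \<le>
    norm (family_inner n 0 * (family_outer \<phi> - family_outer 0))"
proof -
  have \<phi>1: "\<bar>\<phi>\<bar> \<le> 1"
    using \<phi> by simp
  let ?D = "family_inner n 0 * (family_outer \<phi> - family_outer 0)"
  have at_even: "(1 / 2) ^ n * norm (strip_inner 0 0) * norm (phase \<phi> * exp (\<i> * of_real \<phi> * of_nat (2 * k)) - phase 0)
      \<le> norm ?D" if "1 \<le> k" for k :: nat
  proof -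
    have "2 \<le> 2 * real k"
      using that by simp
    from to_strip_surj_real [OF this] obtain z where
      z: "z \<in> ball 0 1" "to_strip z = of_real (2 * real k)" "1 / 2 \<le> norm z"
      by blast
    have "norm (happ ?D z) = norm z ^ n * norm (strip_inner 0 (2 * of_nat k)) *
        norm (phase \<phi> * exp (\<i> * of_real \<phi> * of_nat (2 * k)) - phase 0)"
      using z \<phi>1 norm_phase [of 0]
      by (simp add: family_inner_def family_outer_def minus_hinf.rep_eq happ_power_id happ_const_hinf
          happ_inner_part happ_unit_part norm_mult norm_power)
    moreover have "(1 / 2) ^ n \<le> norm z ^ n"
      using z(3) by (intro power_mono) auto
    ultimately have "(1 / 2) ^ n * norm (strip_inner 0 0) *
        norm (phase \<phi> * exp (\<i> * of_real \<phi> * of_nat (2 * k)) - phase 0) \<le> norm (happ ?D z)"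
      by (simp add: norm_strip_inner_even mult_right_mono)
    then show ?thesis
      using norm_happ_le order_trans by blast
  qed
  have "\<i> * of_real \<phi> * of_nat (2 * m) = of_real pi * \<i>"
    "\<i> * of_real \<phi> * of_nat (2 * (2 * m)) = 2 * of_real pi * \<i>"
    using assms(1) by (auto simp: \<phi>(1) field_simps)
  then have e: "exp (\<i> * of_real \<phi> * of_nat (2 * m)) = - 1"
    "exp (\<i> * of_real \<phi> * of_nat (2 * (2 * m))) = 1"
    by (simp_all only: exp_pi_i exp_two_pi_i)
  have "norm (2 * phase 0) \<le> norm (phase \<phi> * (- 1) - phase 0) + norm (phase \<phi> * 1 - phase 0)"
    using norm_triangle_ineq [of "phase \<phi> * (- 1) - phase 0" "phase \<phi> * 1 - phase 0"]
    by (simp add: norm_minus_commute [of "- phase \<phi> - phase 0"])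
  then have "1 \<le> norm (phase \<phi> * (- 1) - phase 0) \<or> 1 \<le> norm (phase \<phi> * 1 - phase 0)"
    using norm_phase [of 0] by (simp add: norm_mult) linarith
  then show ?thesis
  proof
    assume "1 \<le> norm (phase \<phi> * (- 1) - phase 0)"
    then have "(1 / 2) ^ n * norm (strip_inner 0 0) * 1 \<le>
        (1 / 2) ^ n * norm (strip_inner 0 0) * norm (phase \<phi> * (- 1) - phase 0)"
      by (intro mult_left_mono) auto
    with at_even [of m] assms(1) show ?thesis
      unfolding e by linarith
  next
    assume "1 \<le> norm (phase \<phi> * 1 - phase 0)"
    then have "(1 / 2) ^ n * norm (strip_inner 0 0) * 1 \<le>
        (1 / 2) ^ n * norm (strip_inner 0 0) * norm (phase \<phi> * 1 - phase 0)"
      by (intro mult_left_mono) auto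
    with at_even [of "2 * m"] assms(1) show ?thesis
      unfolding e by linarith
  qed
qed

lemma norm_family_outer:
  assumes \<phi>: "\<bar>\<phi>\<bar> \<le> 1"
  shows "norm (family_outer \<phi>) \<le> exp 2"
proof (rule norm_hinf_leI)
  fix z :: complex assume z: "z \<in> ball 0 1"
  show "norm (happ (family_outer \<phi>) z) \<le> exp 2"
    using norm_exp_strip [OF \<phi> to_strip_in_strip [OF z]] norm_phase [OF \<phi>]
      happ_const_hinf [OF z] happ_unit_part [OF \<phi> z]
    by (simp add: family_outer_def norm_mult del: norm_exp_eq_Re)
qed

theorem theorem3p4:
  fixes n :: nat
  shows "\<not> continuous_on (I_star_n n) Q_inn \<and> \<not> continuous_on (I_star_n n) Q_out"
proof -
  \<comment> \<open>the offset 2 keeps the parameter below 1, so that the zeros stay inside the strip\<close>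
  define \<phi> where "\<phi> m = pi / (2 * real (m + 2))" for m
  define A where "A = family_inner n"
  define B where "B = family_outer"
  have \<phi>1: "0 < \<phi> m" "\<phi> m \<le> 1" "\<bar>\<phi> m\<bar> \<le> 1" for m
    using pi_less_4 by (auto simp: \<phi>_def field_simps)
  have "\<phi> \<longlonglongrightarrow> 0"
    unfolding \<phi>_def by real_asymp
  then have "filterlim \<phi> (at 0) sequentially"
    using \<phi>1(1) by (auto simp: filterlim_at intro!: always_eventually less_imp_neq [symmetric])
  then have lim: "(\<lambda>m. family n (\<phi> m)) \<longlonglongrightarrow> family n 0"
    by (rule filterlim_compose [OF family_tendsto])
  have apart: "(1 / 2) ^ n * norm (strip_inner 0 0) \<le> norm (A 0 * (B (\<phi> m) - B 0))" for m
    unfolding A_def B_def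
    by (rule outer_parts_apart [of "m + 2"]) (use \<phi>1 in \<open>simp_all add: \<phi>_def\<close>)
  have no_limit: "\<not> (\<lambda>m. A 0 * (B (\<phi> m) - B 0)) \<longlonglongrightarrow> 0"
  proof
    assume "(\<lambda>m. A 0 * (B (\<phi> m) - B 0)) \<longlonglongrightarrow> 0"
    then have "(\<lambda>m. norm (A 0 * (B (\<phi> m) - B 0))) \<longlonglongrightarrow> 0"
      by (rule tendsto_norm_zero)
    then have "(1 / 2) ^ n * norm (strip_inner 0 0) \<le> 0"
      by (rule LIMSEQ_le_const) (use apart in blast)
    moreover have "0 < (1 / 2) ^ n * norm (strip_inner 0 0)"
      using strip_inner_0_nonzero [of 0] by (intro mult_pos_pos) auto
    ultimately show False by simp
  qed
  have "\<not> continuous_on (I_star_n n) Q_out"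
  proof
    assume "continuous_on (I_star_n n) Q_out"
    then have "(\<lambda>m. Q_out (family n (\<phi> m))) \<longlonglongrightarrow> Q_out (family n 0)"
      by (rule continuous_on_tendsto_compose [OF _ lim]) (auto simp: family_in_I_star \<phi>1)
    then have "(\<lambda>m. B (\<phi> m)) \<longlonglongrightarrow> B 0"
      by (simp add: family_factorization \<phi>1 B_def)
    then have "(\<lambda>m. A 0 * (B (\<phi> m) - B 0)) \<longlonglongrightarrow> A 0 * (B 0 - B 0)"
      by (intro tendsto_intros)
    with no_limit show False by simp
  qed
  moreover have "\<not> continuous_on (I_star_n n) Q_inn"
  proof
    assume "continuous_on (I_star_n n) Q_inn"
    then have "(\<lambda>m. Q_inn (family n (\<phi> m))) \<longlonglongrightarrow> Q_inn (family n 0)"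
      by (rule continuous_on_tendsto_compose [OF _ lim]) (auto simp: family_in_I_star \<phi>1)
    then have "(\<lambda>m. A (\<phi> m)) \<longlonglongrightarrow> A 0"
      by (simp add: family_factorization \<phi>1 A_def)
    then have "(\<lambda>m. A (\<phi> m) - A 0) \<longlonglongrightarrow> 0"
      by (simp add: LIM_zero_iff)
    then have null: "(\<lambda>m. norm (A (\<phi> m) - A 0) * exp 2) \<longlonglongrightarrow> 0"
      by (intro tendsto_mult_left_zero tendsto_norm_zero)
    have "norm ((A (\<phi> m) - A 0) * B (\<phi> m)) \<le> norm (A (\<phi> m) - A 0) * exp 2" for m
    proof -
      have "norm ((A (\<phi> m) - A 0) * B (\<phi> m)) \<le> norm (A (\<phi> m) - A 0) * norm (B (\<phi> m))"
        by (rule norm_mult_ineq)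
      also have "\<dots> \<le> norm (A (\<phi> m) - A 0) * exp 2"
        unfolding B_def by (intro mult_left_mono norm_family_outer \<phi>1 norm_ge_zero)
      finally show ?thesis .
    qed
    then have "(\<lambda>m. (A (\<phi> m) - A 0) * B (\<phi> m)) \<longlonglongrightarrow> 0"
      by (intro Lim_null_comparison [OF _ null] always_eventually allI)
    moreover have "(\<lambda>m. family n (\<phi> m) - family n 0) \<longlonglongrightarrow> 0"
      using lim by (simp add: LIM_zero_iff)
    ultimately have "(\<lambda>m. (family n (\<phi> m) - family n 0) - (A (\<phi> m) - A 0) * B (\<phi> m)) \<longlonglongrightarrow> 0 - 0"
      by (intro tendsto_diff)
    \<comment> \<open>convergence of the products and of the inner factors would force that of the outer factors\<close>
    moreover have "(family n (\<phi> m) - family n 0) - (A (\<phi> m) - A 0) * B (\<phi> m) = A 0 * (B (\<phi> m) - B 0)" for m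
      by (simp add: family_def A_def B_def algebra_simps)
    ultimately show False
      using no_limit by simp
  qed
  ultimately show ?thesis by blast
qed

end
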